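(* Let $H\in(0,d_w-d_h)$, let $w=(i_1,\dots,i_n)\in\{1,2,3\}^n$, let $F_w=F_{i_1}\circ\cdots\circ F_{i_n}$ and let $K_w=F_w(K)\subset K$. Let $X^w$ be a fractional Brownian field with parameter $H$ on $K_w$. Then the Gaussian field $$\left(2^{nH}X^w(F_w(x))\right)_{x\in K}$$ is (in distribution) a fractional Brownian field with parameter $H$ on $K$.
   Context: Gasket and Laplacian. Let $q_0=0$, $q_1=1$, $q_2=e^{i\pi/3}$ in $\mathbb{C}\simeq\mathbb{R}^2$ and $F_i(z)=\frac12(z-q_{i-1})+q_{i-1}$ for $i=1,2,3$. The Sierpiński gasket $K$ is the unique non-empty compact set with $K=\bigcup_{i=1}^3F_i(K)$, and $\mu$ is the Borel measure on $K$ with $\mu(F_{i_1}\circ\cdots\circ F_{i_n}(K))=3^{-n}$ for all $i_1,\dots,i_n\in\{1,2,3\}$. $d_h=\frac{\ln3}{\ln2}$ and $d_w=\frac{\ln5}{\ln2}$. Put $V_0=\{q_0,q_1,q_2\}$, $V_m=\bigcup_{i_1,\dots,i_m}F_{i_1}\circ\cdots\circ F_{i_m}(V_0)$, $V_*=\bigcup_{m\ge0}V_m$, and $$\mathcal{E}_m(f,f)=\frac12\Big(\frac53\Big)^m\sum_{i_1,\dots,i_m}\sum_{x,y\in V_0}\big(f(F_{i_1}\circ\cdots\circ F_{i_m}(x))-f(F_{i_1}\circ\cdots\circ F_{i_m}(y))\big)^2 .$$ Functions $f:V_*\to\mathbb{R}$ with $\mathcal{E}(f,f):=\lim_m\mathcal{E}_m(f,f)<\infty$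 extend uniquely to continuous functions on $K$; $\mathcal{F}$ is the set of these extensions. $(\mathcal{E},\mathcal{F})$ is a local regular Dirichlet form on $L^2(K,\mu)$ with generator $\Delta$ (so $\mathcal{E}(f,g)=-\int_K(\Delta f)g\,d\mu$). Its semigroup $P_t=e^{t\Delta}$ satisfies $P_t1=1$ and has a jointly continuous heat kernel $p_t(x,y)$ with respect to $\mu$. Field on $K$. For $s>0$, $x\ne y$, $G_s(x,y)=\frac1{\Gamma(s)}\int_0^{+\infty}t^{s-1}(p_t(x,y)-1)\,dt$; for $s>\frac{d_h}{2d_w}$, $G_s(x,\cdot)\in L_0^2(K,\mu)=\{f\in L^2(K,\mu):\int_Kf\,d\mu=0\}$. A white noise $W_K$ on $L_0^2(K,\mu)$ is a linear map $f\mapsto\int_Kf\,dW_K$ into centered jointly Gaussian real random variables with $\mathbb{E}\left(\int_Kf\,dW_K\int_Kg\,dW_K\right)=\int_Kfg\,d\mu$. The fractional Brownian field with parameter $H$ on $K$ is $X(x)=\int_KG_s(x,z)\,W_K(dz)$, $x\in K$, with $s=\frac{d_h+2H}{2d_w}$. Field on $K_w$. The same construction is carried out on $K_w$, equipped with the restriction of $\mu$ (so $\mu(K_w)=3^{-n}$). The Dirichlet form on $K_w$ is $\mathcal{E}_w(f,f)=\lim_{m\to\infty}\frac12(5/3)^m\sum\sum_{x,y\in V_0}(f(F_{j_1}\circ\cdots\circ F_{j_m}(x))-f(F_{j_1}\circ\cdots\circ F_{j_m}(y)))^2$, where the first sum is over $(j_1,\dots,j_m)$ with $(j_1,\dots,j_n)=w$;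 its domain $\mathcal{F}_w$ is the set of continuous $f$ on $K_w$ for which the limit is finite. $\Delta_w$ is its generator on $L^2(K_w,\mu)$, $p^w_t$ its heat kernel with respect to $\mu|_{K_w}$, and $$G^w_s(x,y)=\frac1{\Gamma(s)}\int_0^{+\infty}t^{s-1}\Big(p_t^w(x,y)-\frac{1}{\mu(K_w)}\Big)dt,\qquad x\ne y\in K_w.$$ The fractional Brownian field with parameter $H$ on $K_w$ is $X^w(x)=\int_{K_w}G_s^w(x,z)\,W_{K_w}(dz)$, $x\in K_w$, with $s=\frac{d_h+2H}{2d_w}$ and $W_{K_w}$ a white noise on $L_0^2(K_w,\mu)=\{f\in L^2(K_w,\mu):\int_{K_w}f\,d\mu=0\}$, i.e. centered Gaussian, linear in the integrand, with covariance $\int_{K_w}fg\,d\mu$. *)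

theory Defs
  imports "HOL-Probability.Probability"
begin

section \<open>The Sierpinski gasket, its measure and its dimensions\<close>

definition q :: "nat \<Rightarrow> complex" where
  "q i = (if i = 0 then 0 else if i = 1 then 1 else cis (pi / 3))"

definition V0 :: "complex set" where
  "V0 = {q 0, q 1, q 2}"

definition F :: "nat \<Rightarrow> complex \<Rightarrow> complex" where
  "F i z = (z - q (i - 1)) / 2 + q (i - 1)"

definition words :: "nat \<Rightarrow> nat list set" where
  "words n = {w. length w = n \<and> set w \<subseteq> {1, 2, 3}}"

definition Fw :: "nat list \<Rightarrow> complex \<Rightarrow> complex" where
  "Fw w = foldr (\<lambda>i g. F i \<circ> g) w id"

definition gasket :: "complex set" where
  "gasket = (THE K. compact K \<and> K \<noteq> {} \<and> K = (\<Union>i\<in>{1, 2, 3}. F i ` K))"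

definition cell :: "nat list \<Rightarrow> complex set" where
  "cell w = Fw w ` gasket"

definition gasket_measure :: "complex measure \<Rightarrow> bool" where
  "gasket_measure \<mu> \<longleftrightarrow>
     sets \<mu> = sets (restrict_space borel gasket) \<and>
     (\<forall>n. \<forall>w\<in>words n. emeasure \<mu> (cell w) = ennreal ((1/3) ^ n))"

definition d_h :: real where "d_h = ln 3 / ln 2"

definition d_w :: real where "d_w = ln 5 / ln 2"

section \<open>The Dirichlet forms on the gasket and on its cells\<close>

text \<open>
  All forms below are the polarised ones: on the diagonal \<open>g = f\<close> they are the usual
  energies, and for \<open>f\<close>, \<open>g\<close> in the domain the off-diagonal limits exist by polarisation.
  Functions on a subset \<open>A\<close> of the plane are represented by total functions whose values
  outside \<open>A\<close> are irrelevant.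
\<close>

definition gasket_energy_level ::
    "nat \<Rightarrow> (complex \<Rightarrow> real) \<Rightarrow> (complex \<Rightarrow> real) \<Rightarrow> real" where
  "gasket_energy_level m f g =
     1/2 * (5/3) ^ m *
       (\<Sum>j\<in>words m. \<Sum>x\<in>V0. \<Sum>y\<in>V0.
          (f (Fw j x) - f (Fw j y)) * (g (Fw j x) - g (Fw j y)))"

definition gasket_energy :: "(complex \<Rightarrow> real) \<Rightarrow> (complex \<Rightarrow> real) \<Rightarrow> real" where
  "gasket_energy f g = lim (\<lambda>m. gasket_energy_level m f g)"

text \<open>
  The level energies only involve the values of \<open>f\<close> on the dense set of vertices of the
  gasket, so this set consists exactly of the continuous extensions of the vertex functions
  of finite energy.
\<close>

definition gasket_domain :: "(complex \<Rightarrow> real) set" where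
  "gasket_domain =
     {f. continuous_on gasket f \<and> convergent (\<lambda>m. gasket_energy_level m f f)}"

text \<open>
  For \<open>m < length w\<close> the outer sum is empty, which does not affect the limit.
\<close>

definition cell_energy_level ::
    "nat list \<Rightarrow> nat \<Rightarrow> (complex \<Rightarrow> real) \<Rightarrow> (complex \<Rightarrow> real) \<Rightarrow> real" where
  "cell_energy_level w m f g =
     1/2 * (5/3) ^ m *
       (\<Sum>j\<in>{j \<in> words m. take (length w) j = w}. \<Sum>x\<in>V0. \<Sum>y\<in>V0.
          (f (Fw j x) - f (Fw j y)) * (g (Fw j x) - g (Fw j y)))"

definition cell_energy :: "nat list \<Rightarrow> (complex \<Rightarrow> real) \<Rightarrow> (complex \<Rightarrow> real) \<Rightarrow> real" where
  "cell_energy w f g = lim (\<lambda>m. cell_energy_level w m f g)"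

definition cell_domain :: "nat list \<Rightarrow> (complex \<Rightarrow> real) set" where
  "cell_domain w =
     {f. continuous_on (cell w) f \<and> convergent (\<lambda>m. cell_energy_level w m f f)}"

section \<open>Generator, semigroup and heat kernel of a form\<close>

text \<open>
  Elements of \<open>L\<^sup>2\<close> are represented by functions; identities between them are stated
  almost everywhere.
\<close>

definition L2 :: "'b measure \<Rightarrow> ('b \<Rightarrow> real) set" where
  "L2 \<nu> = {f \<in> borel_measurable \<nu>. integrable \<nu> (\<lambda>x. (f x)\<^sup>2)}"

definition L20 :: "'b measure \<Rightarrow> ('b \<Rightarrow> real) set" where
  "L20 \<nu> = {f \<in> L2 \<nu>. (\<integral>x. f x \<partial>\<nu>) = 0}"

text \<open>
  \<open>form_generator \<nu> D E u h\<close>: \<open>u\<close> belongs to the domain of the generator of the form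
  \<open>E\<close> with domain \<open>D\<close>, and the generator maps \<open>u\<close> to \<open>h\<close>.
\<close>

definition form_generator ::
    "'b measure \<Rightarrow> ('b \<Rightarrow> real) set \<Rightarrow> (('b \<Rightarrow> real) \<Rightarrow> ('b \<Rightarrow> real) \<Rightarrow> real) \<Rightarrow>
     ('b \<Rightarrow> real) \<Rightarrow> ('b \<Rightarrow> real) \<Rightarrow> bool" where
  "form_generator \<nu> D E u h \<longleftrightarrow>
     u \<in> L2 \<nu> \<and> h \<in> L2 \<nu> \<and>
     (\<exists>v\<in>D. (AE x in \<nu>. u x = v x) \<and> (\<forall>g\<in>D. E v g = - (\<integral>x. h x * g x \<partial>\<nu>)))"

text \<open>
  \<open>P\<close> is the strongly continuous contraction semigroup on \<open>L\<^sup>2\<close> whose infinitesimal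
  generator is the operator with graph \<open>A\<close>. Well-definedness on classes is implied
  by linearity and contractivity.
\<close>

definition semigroup_generated_by ::
    "'b measure \<Rightarrow> (('b \<Rightarrow> real) \<Rightarrow> ('b \<Rightarrow> real) \<Rightarrow> bool) \<Rightarrow>
     (real \<Rightarrow> ('b \<Rightarrow> real) \<Rightarrow> ('b \<Rightarrow> real)) \<Rightarrow> bool" where
  "semigroup_generated_by \<nu> A P \<longleftrightarrow>
     (\<forall>t\<ge>0. \<forall>f\<in>L2 \<nu>. P t f \<in> L2 \<nu> \<and> (\<integral>x. (P t f x)\<^sup>2 \<partial>\<nu>) \<le> (\<integral>x. (f x)\<^sup>2 \<partial>\<nu>)) \<and>
     (\<forall>t\<ge>0. \<forall>f\<in>L2 \<nu>. \<forall>g\<in>L2 \<nu>. \<forall>a b.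
        AE x in \<nu>. P t (\<lambda>y. a * f y + b * g y) x = a * P t f x + b * P t g x) \<and>
     (\<forall>f\<in>L2 \<nu>. AE x in \<nu>. P 0 f x = f x) \<and>
     (\<forall>s\<ge>0. \<forall>t\<ge>0. \<forall>f\<in>L2 \<nu>. AE x in \<nu>. P (s + t) f x = P s (P t f) x) \<and>
     (\<forall>f\<in>L2 \<nu>. ((\<lambda>t. \<integral>x. (P t f x - f x)\<^sup>2 \<partial>\<nu>) \<longlongrightarrow> 0) (at_right 0)) \<and>
     (\<forall>f\<in>L2 \<nu>. \<forall>h\<in>L2 \<nu>.
        ((\<lambda>t. \<integral>x. ((P t f x - f x) / t - h x)\<^sup>2 \<partial>\<nu>) \<longlongrightarrow> 0) (at_right 0) \<longleftrightarrow> A f h)"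

definition heat_kernel ::
    "'b::topological_space measure \<Rightarrow> ('b \<Rightarrow> real) set \<Rightarrow>
     (('b \<Rightarrow> real) \<Rightarrow> ('b \<Rightarrow> real) \<Rightarrow> real) \<Rightarrow> (real \<Rightarrow> 'b \<Rightarrow> 'b \<Rightarrow> real) \<Rightarrow> bool" where
  "heat_kernel \<nu> D E p \<longleftrightarrow>
     continuous_on ({0<..} \<times> space \<nu> \<times> space \<nu>) (\<lambda>(t, x, y). p t x y) \<and>
     (\<exists>P. semigroup_generated_by \<nu> (form_generator \<nu> D E) P \<and>
        (\<forall>t>0. \<forall>f\<in>L2 \<nu>. AE x in \<nu>. P t f x = (\<integral>y. p t x y * f y \<partial>\<nu>)))"

text \<open>
  Only the values off the diagonal are meaningful (and points are null sets for the
  measures used here).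
\<close>

definition green ::
    "'b measure \<Rightarrow> (real \<Rightarrow> 'b \<Rightarrow> 'b \<Rightarrow> real) \<Rightarrow> real \<Rightarrow> 'b \<Rightarrow> 'b \<Rightarrow> real" where
  "green \<nu> p s x y =
     1 / Gamma s *
       (LINT t:{0<..}|lborel. t powr (s - 1) * (p t x y - 1 / measure \<nu> (space \<nu>)))"

section \<open>White noise and fractional Brownian fields\<close>

definition centered_gaussian :: "'a measure \<Rightarrow> ('a \<Rightarrow> real) \<Rightarrow> bool" where
  "centered_gaussian M Y \<longleftrightarrow>
     Y \<in> borel_measurable M \<and>
     ((AE \<omega> in M. Y \<omega> = 0) \<or> (\<exists>\<sigma>>0. distributed M lborel Y (normal_density 0 \<sigma>)))"

definition jointly_centered_gaussian ::
    "'a measure \<Rightarrow> 'i set \<Rightarrow> ('i \<Rightarrow> 'a \<Rightarrow> real) \<Rightarrow> bool" where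
  "jointly_centered_gaussian M I Z \<longleftrightarrow>
     (\<forall>S c. finite S \<and> S \<subseteq> I \<longrightarrow> centered_gaussian M (\<lambda>\<omega>. \<Sum>i\<in>S. c i * Z i \<omega>))"

definition white_noise ::
    "'a measure \<Rightarrow> 'b measure \<Rightarrow> (('b \<Rightarrow> real) \<Rightarrow> 'a \<Rightarrow> real) \<Rightarrow> bool" where
  "white_noise M \<nu> W \<longleftrightarrow>
     jointly_centered_gaussian M (L20 \<nu>) W \<and>
     (\<forall>f\<in>L20 \<nu>. \<forall>g\<in>L20 \<nu>. \<forall>a b.
        AE \<omega> in M. W (\<lambda>x. a * f x + b * g x) \<omega> = a * W f \<omega> + b * W g \<omega>) \<and>
     (\<forall>f\<in>L20 \<nu>. \<forall>g\<in>L20 \<nu>.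
        (\<integral>\<omega>. W f \<omega> * W g \<omega> \<partial>M) = (\<integral>x. f x * g x \<partial>\<nu>))"

text \<open>
  The condition that \<open>green \<nu> p s x\<close> lies in \<open>L20 \<nu>\<close> says that the Wiener integral is
  meaningful; for the gasket and its cells it holds for every \<open>H > 0\<close>.
\<close>

definition fractional_brownian_field ::
    "'a measure \<Rightarrow> 'b::topological_space measure \<Rightarrow> ('b \<Rightarrow> real) set \<Rightarrow>
     (('b \<Rightarrow> real) \<Rightarrow> ('b \<Rightarrow> real) \<Rightarrow> real) \<Rightarrow> real \<Rightarrow> ('b \<Rightarrow> 'a \<Rightarrow> real) \<Rightarrow> bool" where
  "fractional_brownian_field M \<nu> D E H X \<longleftrightarrow>
     prob_space M \<and>
     (\<forall>x\<in>space \<nu>. X x \<in> borel_measurable M) \<and>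
     (\<exists>p W. heat_kernel \<nu> D E p \<and> white_noise M \<nu> W \<and>
        (let s = (d_h + 2 * H) / (2 * d_w) in
         \<forall>x\<in>space \<nu>. green \<nu> p s x \<in> L20 \<nu> \<and> (AE \<omega> in M. X x \<omega> = W (green \<nu> p s x) \<omega>)))"

definition gasket_fbf ::
    "complex measure \<Rightarrow> 'a measure \<Rightarrow> real \<Rightarrow> (complex \<Rightarrow> 'a \<Rightarrow> real) \<Rightarrow> bool" where
  "gasket_fbf \<mu> M H X \<longleftrightarrow>
     fractional_brownian_field M \<mu> gasket_domain gasket_energy H X"

definition cell_fbf ::
    "complex measure \<Rightarrow> nat list \<Rightarrow> 'a measure \<Rightarrow> real \<Rightarrow> (complex \<Rightarrow> 'a \<Rightarrow> real) \<Rightarrow> bool" where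
  "cell_fbf \<mu> w M H X \<longleftrightarrow>
     fractional_brownian_field M (restrict_space \<mu> (cell w)) (cell_domain w) (cell_energy w) H X"

definition field_law ::
    "'b set \<Rightarrow> 'a measure \<Rightarrow> ('b \<Rightarrow> 'a \<Rightarrow> real) \<Rightarrow> ('b \<Rightarrow> real) measure" where
  "field_law T M X = distr M (PiM T (\<lambda>_. borel)) (\<lambda>\<omega>. \<lambda>x\<in>T. X x \<omega>)"

end

theory Submission
  imports Defs
begin

text \<open>
  The similarity \<open>F\<^sub>w\<close> from the gasket \<open>K\<close> onto the cell \<open>K\<^sub>w\<close> multiplies the measure by
  \<open>c = 3\<^sup>-\<^sup>n\<close> and the Dirichlet form by \<open>e = (5/3)\<^sup>n\<close>. Everything that enters the field is built
  from these two data, so it is transported by \<open>F\<^sub>w\<close> up to explicit factors. A generator is a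
  form divided by a measure, so \<open>\<Delta>\<^sub>w\<close> corresponds to \<open>r \<Delta>\<close> with \<open>r = e / c = 5\<^sup>n\<close>, that is, to
  time running \<open>r\<close> times faster. A kernel is a density with respect to the measure,
  hence \<open>p t x y = c p\<^sup>w (t/r) (F\<^sub>w x) (F\<^sub>w y)\<close>, and the substitution \<open>t = r \<tau>\<close> in the integral over
  time gives \<open>G\<^sub>s = c r\<^sup>s G\<^sub>s\<^sup>w\<close>. A white noise on \<open>K\<^sub>w\<close> becomes one on \<open>K\<close> after
  division by \<open>\<surd>c\<close>. Therefore the field on \<open>K\<close> built from the transported noise is
  \<open>\<surd>c r\<^sup>s X\<^sup>w \<circ> F\<^sub>w\<close>, and for \<open>s = (d\<^sub>h + 2H) / (2d\<^sub>w)\<close> the relations \<open>2\<close> to the power \<open>d\<^sub>h\<close> is 3 and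
  \<open>2\<close> to the power \<open>d\<^sub>w\<close> is 5 turn the factor into \<open>2\<close> to the power \<open>nH\<close> (\<open>scaling_exponent\<close>).
  In particular the rescaled field is itself a fractional Brownian field on \<open>K\<close>, on the same
  probability space. This transport, for any two spaces related by a similarity, is
  the locale \<open>scaled_copy\<close>, with the conclusion \<open>fractional_brownian_field_pullback\<close>.

  Two facts about the gasket make \<open>F\<^sub>w\<close> such a similarity. The first is that the values on
  cells determine the measure (\<open>gasket_measure_unique\<close>): then \<open>3\<^sup>n\<close> times the restriction of
  the measure to \<open>K\<^sub>w\<close>, pulled back to \<open>K\<close>, has to be the measure of \<open>K\<close> itself, because it has the
  right values on cells. The second is that the level energies of a pair of functions in the
  domain converge (\<open>convergent_gasket_energy_level\<close>), so that the relation between the level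
  energies passes to the limit forms. It follows by polarisation once the diagonal level energies
  are known to increase, which is the harmonic extension inequality on a single triangle.
\<close>

section \<open>Transport along a similarity of Dirichlet spaces\<close>

lemma L2_cmult_iff:
  fixes a :: real and h :: "'b \<Rightarrow> real" and M' :: "'b measure"
  assumes "a \<noteq> 0"
  shows "(\<lambda>y. a * h y) \<in> L2 M' \<longleftrightarrow> h \<in> L2 M'"
proof -
  have "(\<lambda>y. a * h y) \<in> borel_measurable M' \<longleftrightarrow> h \<in> borel_measurable M'"
  proof
    assume "(\<lambda>y. a * h y) \<in> borel_measurable M'"
    then have "(\<lambda>y. 1 / a * (a * h y)) \<in> borel_measurable M'"
      by (rule borel_measurable_times[OF borel_measurable_const])
    also have "(\<lambda>y. 1 / a * (a * h y)) = h" using assms by (simp add: fun_eq_iff)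
    finally show "h \<in> borel_measurable M'" .
  qed (intro borel_measurable_times borel_measurable_const)
  then show ?thesis using assms by (simp add: L2_def power_mult_distrib)
qed

lemma white_noise_scaleR:
  fixes W :: "('b \<Rightarrow> real) \<Rightarrow> 'a \<Rightarrow> real"
  assumes "white_noise M \<rho> W" "f \<in> L20 \<rho>"
  shows "AE \<omega> in M. W (\<lambda>x. a * f x) \<omega> = a * W f \<omega>"
proof -
  have "AE \<omega> in M. W (\<lambda>x. a * f x + 0 * f x) \<omega> = a * W f \<omega> + 0 * W f \<omega>"
    using assms unfolding white_noise_def by blast
  then show ?thesis by simp
qed

text \<open>
  \<open>\<nu>'\<close> and \<open>E'\<close> are \<open>\<nu>\<close> and \<open>E\<close> transported by \<open>\<phi>\<close> and multiplied by \<open>c\<close> and \<open>e\<close>.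
  Elements of \<open>L\<^sup>2\<close> and of the domains are represented by functions on the whole types, so
  \<open>\<phi>\<close> and \<open>\<psi>\<close> are inverse to each other on the whole types and not only on the
  spaces of the measures; composition with them is then a bijection between representatives.
\<close>

locale scaled_copy =
  fixes \<nu> :: "'b::topological_space measure" and \<nu>' :: "'c::topological_space measure"
    and \<phi> :: "'b \<Rightarrow> 'c" and \<psi> :: "'c \<Rightarrow> 'b"
    and D :: "('b \<Rightarrow> real) set" and D' :: "('c \<Rightarrow> real) set"
    and E :: "('b \<Rightarrow> real) \<Rightarrow> ('b \<Rightarrow> real) \<Rightarrow> real"
    and E' :: "('c \<Rightarrow> real) \<Rightarrow> ('c \<Rightarrow> real) \<Rightarrow> real"
    and c e :: real
  assumes c_pos: "0 < c" and e_pos: "0 < e"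
    and \<psi>_\<phi> [simp]: "\<psi> (\<phi> x) = x" and \<phi>_\<psi> [simp]: "\<phi> (\<psi> y) = y"
    and \<phi>_measurable [measurable]: "\<phi> \<in> measurable \<nu> \<nu>'"
    and \<psi>_measurable [measurable]: "\<psi> \<in> measurable \<nu>' \<nu>"
    and \<phi>_continuous: "continuous_on (space \<nu>) \<phi>"
    and distr_\<psi>: "distr \<nu>' \<nu> \<psi> = density \<nu> (\<lambda>_. ennreal c)"
    and domain_iff: "u \<in> D' \<longleftrightarrow> (\<lambda>x. u (\<phi> x)) \<in> D"
    and form_eq: "u \<in> D' \<Longrightarrow> v \<in> D' \<Longrightarrow> E' u v = e * E (\<lambda>x. u (\<phi> x)) (\<lambda>x. v (\<phi> x))"
begin

lemma borel_measurable_pullback_iff: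
  fixes f :: "'b \<Rightarrow> real"
  shows "(\<lambda>y. f (\<psi> y)) \<in> borel_measurable \<nu>' \<longleftrightarrow> f \<in> borel_measurable \<nu>"
proof
  assume "(\<lambda>y. f (\<psi> y)) \<in> borel_measurable \<nu>'"
  then have "(\<lambda>x. f (\<psi> (\<phi> x))) \<in> borel_measurable \<nu>"
    by (rule measurable_compose[OF \<phi>_measurable])
  then show "f \<in> borel_measurable \<nu>" by simp
qed (rule measurable_compose[OF \<psi>_measurable])

lemma integrable_pullback_iff:
  fixes f :: "'b \<Rightarrow> real"
  shows "integrable \<nu>' (\<lambda>y. f (\<psi> y)) \<longleftrightarrow> integrable \<nu> f"
proof (cases "f \<in> borel_measurable \<nu>")
  case True
  have "integrable \<nu>' (\<lambda>y. f (\<psi> y)) \<longleftrightarrow> integrable (density \<nu> (\<lambda>_. ennreal c)) f"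
    using integrable_distr_eq[OF \<psi>_measurable True] unfolding distr_\<psi> by simp
  also have "\<dots> \<longleftrightarrow> integrable \<nu> (\<lambda>x. c *\<^sub>R f x)"
    using c_pos by (intro integrable_density True) auto
  finally show ?thesis using c_pos by simp
next
  case False
  then show ?thesis
    using borel_measurable_pullback_iff[of f] borel_measurable_integrable by blast
qed

lemma integral_pullback:
  fixes f :: "'b \<Rightarrow> real"
  shows "(\<integral>y. f (\<psi> y) \<partial>\<nu>') = c * (\<integral>x. f x \<partial>\<nu>)"
proof (cases "f \<in> borel_measurable \<nu>")
  case True
  have "(\<integral>y. f (\<psi> y) \<partial>\<nu>') = integral\<^sup>L (density \<nu> (\<lambda>_. ennreal c)) f"
    using integral_distr[OF \<psi>_measurable True] unfolding distr_\<psi> by simp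
  also have "\<dots> = (\<integral>x. c *\<^sub>R f x \<partial>\<nu>)"
    using c_pos by (intro integral_density True) auto
  finally show ?thesis by simp
next
  case False
  \<comment> \<open>Both integrals have the default value 0.\<close>
  then have "\<not> integrable \<nu> f" "\<not> integrable \<nu>' (\<lambda>y. f (\<psi> y))"
    using borel_measurable_pullback_iff[of f] borel_measurable_integrable by blast+
  then show ?thesis by (simp add: not_integrable_integral_eq)
qed

lemma integral_pushforward:
  fixes g :: "'c \<Rightarrow> real"
  shows "(\<integral>y. g y \<partial>\<nu>') = c * (\<integral>x. g (\<phi> x) \<partial>\<nu>)"
  using integral_pullback[of "\<lambda>x. g (\<phi> x)"] by simp

lemma L2_pullback_iff: "(\<lambda>y. f (\<psi> y)) \<in> L2 \<nu>' \<longleftrightarrow> f \<in> L2 \<nu>"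
  using borel_measurable_pullback_iff[of f] integrable_pullback_iff[of "\<lambda>x. (f x)\<^sup>2"]
  by (simp add: L2_def)

lemma L2_pushforward_iff: "(\<lambda>x. g (\<phi> x)) \<in> L2 \<nu> \<longleftrightarrow> g \<in> L2 \<nu>'"
  using L2_pullback_iff[of "\<lambda>x. g (\<phi> x)"] by simp

lemma L20_pullback_iff: "(\<lambda>y. f (\<psi> y)) \<in> L20 \<nu>' \<longleftrightarrow> f \<in> L20 \<nu>"
  using integral_pullback[of f] L2_pullback_iff[of f] c_pos by (simp add: L20_def)

lemma AE_pushforward:
  assumes "AE y in \<nu>'. Q y"
  shows "AE x in \<nu>. Q (\<phi> x)"
proof -
  obtain N where N: "N \<in> null_sets \<nu>'" "{y \<in> space \<nu>'. \<not> Q y} \<subseteq> N"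
    using assms by (auto simp: eventually_ae_filter)
  define B where "B = \<phi> -` N \<inter> space \<nu>"
  have N_sets: "N \<in> sets \<nu>'" using N(1) by auto
  have B_sets: "B \<in> sets \<nu>" unfolding B_def using N_sets by measurable
  have "ennreal c * emeasure \<nu> B = emeasure (distr \<nu>' \<nu> \<psi>) B"
    using B_sets by (simp add: distr_\<psi> emeasure_density_const)
  also have "\<dots> = emeasure \<nu>' (\<psi> -` B \<inter> space \<nu>')"
    using B_sets by (simp add: emeasure_distr)
  also have "\<psi> -` B \<inter> space \<nu>' = N"
    using sets.sets_into_space[OF N_sets] measurable_space[OF \<psi>_measurable]
    by (auto simp: B_def)
  also have "emeasure \<nu>' N = 0" using N(1) by auto
  finally have "emeasure \<nu> B = 0" using c_pos by simp
  then have "B \<in> null_sets \<nu>" using B_sets by auto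
  moreover have "{x \<in> space \<nu>. \<not> Q (\<phi> x)} \<subseteq> B"
    using N(2) measurable_space[OF \<phi>_measurable] by (auto simp: B_def)
  ultimately show ?thesis by (auto simp: eventually_ae_filter)
qed

lemma AE_pullback_iff: "(AE y in \<nu>'. Q (\<psi> y)) \<longleftrightarrow> (AE x in \<nu>. Q x)"
proof
  assume "AE y in \<nu>'. Q (\<psi> y)"
  from AE_pushforward[OF this] show "AE x in \<nu>. Q x" by simp
next
  assume "AE x in \<nu>. Q x"
  then have "AE x in distr \<nu>' \<nu> \<psi>. Q x"
    unfolding distr_\<psi> by (subst AE_density) auto
  then show "AE y in \<nu>'. Q (\<psi> y)" by (rule AE_distrD[OF \<psi>_measurable])
qed

text \<open>
  Multiplying the weak equation \<open>E v g = - \<integral> h g\<close> by \<open>e\<close> gives the form on the other side, and the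
  integral there carries the factor \<open>c\<close>; so the image \<open>h\<close> of \<open>u\<close> has to be multiplied by \<open>e / c\<close>.
\<close>

lemma form_generator_pullback:
  "form_generator \<nu>' D' E' (\<lambda>y. u (\<psi> y)) (\<lambda>y. e / c * h (\<psi> y)) \<longleftrightarrow> form_generator \<nu> D E u h"
proof -
  define r where "r = e / c"
  have r: "r \<noteq> 0" "e = r * c" using c_pos e_pos by (auto simp: r_def)
  have key: "E' v' g' = - (\<integral>y. r * h (\<psi> y) * g' y \<partial>\<nu>') \<longleftrightarrow>
        E (\<lambda>x. v' (\<phi> x)) (\<lambda>x. g' (\<phi> x)) = - (\<integral>x. h x * g' (\<phi> x) \<partial>\<nu>)"
    if "v' \<in> D'" "g' \<in> D'" for v' g'
  proof -
    have "(\<integral>y. r * h (\<psi> y) * g' y \<partial>\<nu>') = e * (\<integral>x. h x * g' (\<phi> x) \<partial>\<nu>)"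
      using integral_pushforward[of "\<lambda>y. r * h (\<psi> y) * g' y"] by (simp add: r(2) mult.assoc)
    then have "E' v' g' = - (\<integral>y. r * h (\<psi> y) * g' y \<partial>\<nu>') \<longleftrightarrow>
        e * E (\<lambda>x. v' (\<phi> x)) (\<lambda>x. g' (\<phi> x)) = e * - (\<integral>x. h x * g' (\<phi> x) \<partial>\<nu>)"
      using form_eq[OF that] by simp
    also have "\<dots> \<longleftrightarrow> E (\<lambda>x. v' (\<phi> x)) (\<lambda>x. g' (\<phi> x)) = - (\<integral>x. h x * g' (\<phi> x) \<partial>\<nu>)"
      using e_pos by (subst mult_left_cancel) auto
    finally show ?thesis .
  qed
  have "(\<exists>v'\<in>D'. (AE y in \<nu>'. u (\<psi> y) = v' y) \<and>
          (\<forall>g'\<in>D'. E' v' g' = - (\<integral>y. r * h (\<psi> y) * g' y \<partial>\<nu>'))) \<longleftrightarrow>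
        (\<exists>v\<in>D. (AE x in \<nu>. u x = v x) \<and> (\<forall>g\<in>D. E v g = - (\<integral>x. h x * g x \<partial>\<nu>)))"
    (is "?L \<longleftrightarrow> ?R")
  proof
    assume ?L
    then obtain v' where v': "v' \<in> D'" "AE y in \<nu>'. u (\<psi> y) = v' y"
      "\<And>g'. g' \<in> D' \<Longrightarrow> E' v' g' = - (\<integral>y. r * h (\<psi> y) * g' y \<partial>\<nu>')" by auto
    have "E (\<lambda>x. v' (\<phi> x)) g = - (\<integral>x. h x * g x \<partial>\<nu>)" if "g \<in> D" for g
    proof -
      have "(\<lambda>y. g (\<psi> y)) \<in> D'" using that by (simp add: domain_iff)
      from v'(3)[OF this] key[OF v'(1) this] show ?thesis by simp
    qed
    moreover have "(\<lambda>x. v' (\<phi> x)) \<in> D" using v'(1) by (simp add: domain_iff)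
    moreover have "AE x in \<nu>. u x = v' (\<phi> x)" using AE_pushforward[OF v'(2)] by simp
    ultimately show ?R by (intro bexI[of _ "\<lambda>x. v' (\<phi> x)"]) auto
  next
    assume ?R
    then obtain v where v: "v \<in> D" "AE x in \<nu>. u x = v x"
      "\<And>g. g \<in> D \<Longrightarrow> E v g = - (\<integral>x. h x * g x \<partial>\<nu>)" by auto
    have v_dom: "(\<lambda>y. v (\<psi> y)) \<in> D'" using v(1) by (simp add: domain_iff)
    have "E' (\<lambda>y. v (\<psi> y)) g' = - (\<integral>y. r * h (\<psi> y) * g' y \<partial>\<nu>')" if "g' \<in> D'" for g'
      using key[OF v_dom that] v(3)[of "\<lambda>x. g' (\<phi> x)"] that by (simp add: domain_iff)
    moreover have "AE y in \<nu>'. u (\<psi> y) = v (\<psi> y)"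
      using v(2) AE_pullback_iff[of "\<lambda>x. u x = v x"] by simp
    ultimately show ?L using v_dom by (intro bexI[of _ "\<lambda>y. v (\<psi> y)"]) auto
  qed
  then show ?thesis
    unfolding form_generator_def r_def[symmetric]
    using r(1) by (simp add: L2_pullback_iff L2_cmult_iff)
qed

text \<open>
  The generator on the target is \<open>e / c\<close> times the transported one, so the transported semigroup
  has to be run with time divided by \<open>e / c\<close>. Each semigroup axiom is then the corresponding axiom
  read through \<open>\<phi>\<close>.
\<close>

lemma semigroup_pullback:
  assumes P': "semigroup_generated_by \<nu>' (form_generator \<nu>' D' E') P'"
  shows "semigroup_generated_by \<nu> (form_generator \<nu> D E)
           (\<lambda>t f x. P' (t / (e / c)) (\<lambda>y. f (\<psi> y)) (\<phi> x))"
proof -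
  define r where "r = e / c"
  have r: "r > 0" using c_pos e_pos by (auto simp: r_def)
  define P where "P = (\<lambda>t f x. P' (t / r) (\<lambda>y. f (\<psi> y)) (\<phi> x))"
  note P'_unf = P'[unfolded semigroup_generated_by_def]
  have contr: "\<And>t f. t \<ge> 0 \<Longrightarrow> f \<in> L2 \<nu>' \<Longrightarrow>
      P' t f \<in> L2 \<nu>' \<and> (\<integral>x. (P' t f x)\<^sup>2 \<partial>\<nu>') \<le> (\<integral>x. (f x)\<^sup>2 \<partial>\<nu>')"
    and lin: "\<And>t f g a b. t \<ge> 0 \<Longrightarrow> f \<in> L2 \<nu>' \<Longrightarrow> g \<in> L2 \<nu>' \<Longrightarrow>
      AE x in \<nu>'. P' t (\<lambda>y. a * f y + b * g y) x = a * P' t f x + b * P' t g x"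
    and zero: "\<And>f. f \<in> L2 \<nu>' \<Longrightarrow> AE x in \<nu>'. P' 0 f x = f x"
    and add: "\<And>s t f. s \<ge> 0 \<Longrightarrow> t \<ge> 0 \<Longrightarrow> f \<in> L2 \<nu>' \<Longrightarrow>
      AE x in \<nu>'. P' (s + t) f x = P' s (P' t f) x"
    and cont: "\<And>f. f \<in> L2 \<nu>' \<Longrightarrow>
      ((\<lambda>t. \<integral>x. (P' t f x - f x)\<^sup>2 \<partial>\<nu>') \<longlongrightarrow> 0) (at_right 0)"
    and gen: "\<And>f h. f \<in> L2 \<nu>' \<Longrightarrow> h \<in> L2 \<nu>' \<Longrightarrow>
      ((\<lambda>t. \<integral>x. ((P' t f x - f x) / t - h x)\<^sup>2 \<partial>\<nu>') \<longlongrightarrow> 0) (at_right 0) \<longleftrightarrow>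
        form_generator \<nu>' D' E' f h"
    using P'_unf by blast+
  \<comment> \<open>The time change \<open>t \<mapsto> t / r\<close> is a homeomorphism of the right neighbourhoods of 0.\<close>
  have time: "((\<lambda>t. G (t / r)) \<longlongrightarrow> (0::real)) (at_right 0) \<longleftrightarrow> (G \<longlongrightarrow> 0) (at_right 0)" for G
  proof -
    have "filtermap (times (1 / r)) (at_right 0) = at_right (0::real)"
      using filtermap_times_pos_at_right[of "1 / r" 0] r by simp
    from filterlim_filtermap[of G "nhds 0" "times (1/r)" "at_right 0", unfolded this]
    show ?thesis by simp
  qed
  have scale: "((\<lambda>t. k * G t) \<longlongrightarrow> (0::real)) (at_right 0) \<longleftrightarrow> (G \<longlongrightarrow> 0) (at_right 0)"
    if "k \<noteq> 0" for G k
    using tendsto_mult_left_iff[OF that, of G 0 "at_right 0"] by simp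
  have int: "(\<integral>x. g (\<phi> x) \<partial>\<nu>) = 1 / c * (\<integral>y. g y \<partial>\<nu>')" for g :: "'c \<Rightarrow> real"
    using integral_pushforward[of g] c_pos by simp
  have int2: "(\<integral>x. (P t f x - f x)\<^sup>2 \<partial>\<nu>)
      = 1 / c * (\<integral>y. (P' (t / r) (\<lambda>y. f (\<psi> y)) y - f (\<psi> y))\<^sup>2 \<partial>\<nu>')" for t f
    using int[of "\<lambda>y. (P' (t / r) (\<lambda>y. f (\<psi> y)) y - f (\<psi> y))\<^sup>2"] by (simp add: P_def)
  \<comment> \<open>The difference quotients at the times \<open>t\<close> and \<open>t / r\<close> differ by the factor \<open>r\<close>.\<close>
  have int3: "(\<integral>x. ((P t f x - f x) / t - h x)\<^sup>2 \<partial>\<nu>) = 1 / (c * r\<^sup>2) *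
      (\<integral>y. ((P' (t / r) (\<lambda>y. f (\<psi> y)) y - f (\<psi> y)) / (t / r) - r * h (\<psi> y))\<^sup>2 \<partial>\<nu>')" for t f h
  proof -
    have sq: "((P' (t / r) (\<lambda>y. f (\<psi> y)) y - f (\<psi> y)) / (t / r) - r * h (\<psi> y))\<^sup>2 =
      r\<^sup>2 * ((P' (t / r) (\<lambda>y. f (\<psi> y)) y - f (\<psi> y)) / t - h (\<psi> y))\<^sup>2" for y
      by (simp add: power_mult_distrib[symmetric] right_diff_distrib mult.commute)
    show ?thesis unfolding sq
      using int[of "\<lambda>y. ((P' (t / r) (\<lambda>y. f (\<psi> y)) y - f (\<psi> y)) / t - h (\<psi> y))\<^sup>2"] r
      by (simp add: P_def)
  qed
  have "semigroup_generated_by \<nu> (form_generator \<nu> D E) P"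
    unfolding semigroup_generated_by_def
  proof (intro conjI allI ballI impI)
    fix t :: real and f assume t: "t \<ge> 0" and f: "f \<in> L2 \<nu>"
    have f': "(\<lambda>y. f (\<psi> y)) \<in> L2 \<nu>'" using f by (simp add: L2_pullback_iff)
    have tr: "t / r \<ge> 0" using t r by simp
    show "P t f \<in> L2 \<nu>"
      unfolding P_def using contr[OF tr f'] L2_pushforward_iff by blast
    have "c * (\<integral>x. (P t f x)\<^sup>2 \<partial>\<nu>) \<le> c * (\<integral>x. (f x)\<^sup>2 \<partial>\<nu>)"
      using contr[OF tr f'] integral_pushforward[of "\<lambda>y. (P' (t / r) (\<lambda>y. f (\<psi> y)) y)\<^sup>2"]
        integral_pullback[of "\<lambda>x. (f x)\<^sup>2"]
      by (simp add: P_def)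
    then show "(\<integral>x. (P t f x)\<^sup>2 \<partial>\<nu>) \<le> (\<integral>x. (f x)\<^sup>2 \<partial>\<nu>)" using c_pos by simp
  next
    fix t :: real and f g and a b :: real
    assume "t \<ge> 0" "f \<in> L2 \<nu>" "g \<in> L2 \<nu>"
    then show "AE x in \<nu>. P t (\<lambda>y. a * f y + b * g y) x = a * P t f x + b * P t g x"
      unfolding P_def using r by (intro AE_pushforward lin) (auto simp: L2_pullback_iff)
  next
    fix f assume "f \<in> L2 \<nu>"
    then have "AE y in \<nu>'. P' 0 (\<lambda>y. f (\<psi> y)) y = f (\<psi> y)"
      by (intro zero) (simp add: L2_pullback_iff)
    from AE_pushforward[OF this] show "AE x in \<nu>. P 0 f x = f x" by (simp add: P_def)
  next
    fix s t :: real and f assume "s \<ge> 0" "t \<ge> 0" "f \<in> L2 \<nu>"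
    then show "AE x in \<nu>. P (s + t) f x = P s (P t f) x"
      unfolding P_def add_divide_distrib \<phi>_\<psi>
      using r by (intro AE_pushforward add) (auto simp: L2_pullback_iff)
  next
    fix f assume "f \<in> L2 \<nu>"
    then have f': "(\<lambda>y. f (\<psi> y)) \<in> L2 \<nu>'" by (simp add: L2_pullback_iff)
    show "((\<lambda>t. \<integral>x. (P t f x - f x)\<^sup>2 \<partial>\<nu>) \<longlongrightarrow> 0) (at_right 0)"
      unfolding int2 using cont[OF f'] c_pos
      by (subst scale) (auto simp: time[of "\<lambda>t. \<integral>y. (P' t (\<lambda>y. f (\<psi> y)) y - f (\<psi> y))\<^sup>2 \<partial>\<nu>'"])
  next
    fix f h assume "f \<in> L2 \<nu>" "h \<in> L2 \<nu>"
    then have fh: "(\<lambda>y. f (\<psi> y)) \<in> L2 \<nu>'" "(\<lambda>y. r * h (\<psi> y)) \<in> L2 \<nu>'"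
      using r by (auto simp: L2_pullback_iff L2_cmult_iff)
    let ?G = "\<lambda>t. \<integral>y. ((P' t (\<lambda>y. f (\<psi> y)) y - f (\<psi> y)) / t - r * h (\<psi> y))\<^sup>2 \<partial>\<nu>'"
    have k: "1 / (c * r\<^sup>2) \<noteq> 0" using c_pos r by simp
    have "((\<lambda>t. \<integral>x. ((P t f x - f x) / t - h x)\<^sup>2 \<partial>\<nu>) \<longlongrightarrow> 0) (at_right 0) \<longleftrightarrow>
        (?G \<longlongrightarrow> 0) (at_right 0)"
      unfolding int3 scale[OF k] by (rule time[of ?G])
    also have "\<dots> \<longleftrightarrow> form_generator \<nu>' D' E' (\<lambda>y. f (\<psi> y)) (\<lambda>y. r * h (\<psi> y))"
      by (rule gen[OF fh])
    also have "\<dots> \<longleftrightarrow> form_generator \<nu> D E f h"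
      unfolding r_def by (rule form_generator_pullback)
    finally show "((\<lambda>t. \<integral>x. ((P t f x - f x) / t - h x)\<^sup>2 \<partial>\<nu>) \<longlongrightarrow> 0) (at_right 0) \<longleftrightarrow>
        form_generator \<nu> D E f h" .
  qed
  then show ?thesis by (simp add: P_def r_def)
qed

text \<open>
  The factor \<open>c\<close> is the density of the change of variables in \<open>\<integral> p t x y f y\<close>.
\<close>

lemma heat_kernel_pullback:
  assumes p': "heat_kernel \<nu>' D' E' p'"
  shows "heat_kernel \<nu> D E (\<lambda>t x y. c * p' (t / (e / c)) (\<phi> x) (\<phi> y))"
proof -
  define r where "r = e / c"
  have r: "r > 0" using c_pos e_pos by (auto simp: r_def)
  obtain P' where P': "semigroup_generated_by \<nu>' (form_generator \<nu>' D' E') P'"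
    and ker: "\<And>t f. t > 0 \<Longrightarrow> f \<in> L2 \<nu>' \<Longrightarrow> AE x in \<nu>'. P' t f x = (\<integral>y. p' t x y * f y \<partial>\<nu>')"
    and cont: "continuous_on ({0<..} \<times> space \<nu>' \<times> space \<nu>') (\<lambda>(t, x, y). p' t x y)"
    using p' unfolding heat_kernel_def by blast
  have \<phi>_on: "continuous_on ({0<..} \<times> space \<nu> \<times> space \<nu>) (\<lambda>z::real \<times> 'b \<times> 'b. \<phi> (f z))"
    if "continuous_on ({0<..} \<times> space \<nu> \<times> space \<nu>) f"
      "f ` ({0<..} \<times> space \<nu> \<times> space \<nu>) \<subseteq> space \<nu>" for f
    by (rule continuous_on_compose2[OF \<phi>_continuous that])
  have inner: "continuous_on ({0<..} \<times> space \<nu> \<times> space \<nu>)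
      (\<lambda>z::real \<times> 'b \<times> 'b. (fst z / r, \<phi> (fst (snd z)), \<phi> (snd (snd z))))"
    using r by (intro continuous_on_Pair \<phi>_on continuous_intros) auto
  have "continuous_on ({0<..} \<times> space \<nu> \<times> space \<nu>)
      (\<lambda>z. (\<lambda>(t, x, y). p' t x y) (fst z / r, \<phi> (fst (snd z)), \<phi> (snd (snd z))))"
    by (rule continuous_on_compose2[OF cont inner])
      (use r measurable_space[OF \<phi>_measurable] in auto)
  then have "continuous_on ({0<..} \<times> space \<nu> \<times> space \<nu>)
      (\<lambda>z. c * (\<lambda>(t, x, y). p' t x y) (fst z / r, \<phi> (fst (snd z)), \<phi> (snd (snd z))))"
    by (intro continuous_on_mult continuous_on_const)
  then have 1: "continuous_on ({0<..} \<times> space \<nu> \<times> space \<nu>)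
      (\<lambda>(t, x, y). c * p' (t / r) (\<phi> x) (\<phi> y))"
    by (simp add: case_prod_unfold)
  have 2: "AE x in \<nu>. P' (t / r) (\<lambda>y. f (\<psi> y)) (\<phi> x)
      = (\<integral>y. c * p' (t / r) (\<phi> x) (\<phi> y) * f y \<partial>\<nu>)" if "t > 0" "f \<in> L2 \<nu>" for t f
  proof -
    have "AE x in \<nu>'. P' (t / r) (\<lambda>y. f (\<psi> y)) x = (\<integral>y. p' (t / r) x y * f (\<psi> y) \<partial>\<nu>')"
      using that r by (intro ker) (auto simp: L2_pullback_iff)
    from AE_pushforward[OF this] show ?thesis
      by (simp add: integral_pushforward mult.assoc)
  qed
  show ?thesis
    unfolding heat_kernel_def r_def[symmetric]
    using 1 2 semigroup_pullback[OF P', folded r_def] by blast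
qed

text \<open>
  The kernel and the subtracted constant \<open>1 / measure \<nu> (space \<nu>)\<close> both scale by \<open>c\<close>, and
  substituting \<open>t = (e/c) \<tau>\<close> turns \<open>t\<^sup>s\<^sup>-\<^sup>1 dt\<close> into \<open>\<tau>\<^sup>s\<^sup>-\<^sup>1 d\<tau>\<close> times the power \<open>s\<close> of \<open>e/c\<close>.
\<close>

lemma green_pullback:
  assumes "measure \<nu>' (space \<nu>') = c * measure \<nu> (space \<nu>)"
  shows "green \<nu> (\<lambda>t x y. c * p' (t / (e / c)) (\<phi> x) (\<phi> y)) s x y
    = c * (e / c) powr s * green \<nu>' p' s (\<phi> x) (\<phi> y)"
proof -
  define r where "r = e / c"
  have r: "r > 0" using c_pos e_pos by (auto simp: r_def)
  define k where "k = (\<lambda>t. indicator {0<..} t * (t powr (s - 1) * (p' t (\<phi> x) (\<phi> y) - 1 / measure \<nu>' (space \<nu>'))))"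
  have m: "1 / measure \<nu> (space \<nu>) = c * (1 / measure \<nu>' (space \<nu>'))"
    unfolding assms using c_pos by (cases "measure \<nu> (space \<nu>) = 0") auto
  have eq: "indicator {0<..} t * (t powr (s - 1) *
      (c * p' (t / r) (\<phi> x) (\<phi> y) - 1 / measure \<nu> (space \<nu>)))
      = c * r powr (s - 1) * k (0 + 1 / r * t)" for t :: real
  proof (cases "t > 0")
    case True
    then have "t powr (s - 1) = r powr (s - 1) * (t / r) powr (s - 1)"
      using r by (simp add: powr_mult[symmetric])
    then show ?thesis unfolding k_def m using True r by (simp add: field_simps)
  next
    case False
    then have "\<not> 0 < t / r" using r by (simp add: field_simps)
    then show ?thesis unfolding k_def using False by (simp add: indicator_def)
  qed
  have "(\<integral>t. k (0 + 1 / r * t) \<partial>lborel) = r * (\<integral>t. k t \<partial>lborel)"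
    using lborel_integral_real_affine[of "1 / r" k 0] r by simp
  then have "(\<integral>t. c * r powr (s - 1) * k (0 + 1 / r * t) \<partial>lborel)
      = c * r powr s * (\<integral>t. k t \<partial>lborel)"
    using r by (simp add: powr_diff del: add_0)
  then show ?thesis
    unfolding green_def set_lebesgue_integral_def real_scaleR_def r_def[symmetric] eq
    by (simp add: k_def[symmetric] del: add_0)
qed

text \<open>
  Composition with \<open>\<psi>\<close> multiplies the inner product of \<open>L\<^sup>2\<close> by \<open>c\<close>, which the
  normalisation \<open>1 / sqrt c\<close> removes from the covariance.
\<close>

lemma white_noise_pullback:
  assumes W: "white_noise M \<nu>' W'"
  shows "white_noise M \<nu> (\<lambda>f \<omega>. 1 / sqrt c * W' (\<lambda>y. f (\<psi> y)) \<omega>)"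
proof -
  define W where "W = (\<lambda>f \<omega>. 1 / sqrt c * W' (\<lambda>y. f (\<psi> y)) \<omega>)"
  have gauss: "\<And>S a. finite S \<Longrightarrow> S \<subseteq> L20 \<nu>' \<Longrightarrow>
      centered_gaussian M (\<lambda>\<omega>. \<Sum>f\<in>S. a f * W' f \<omega>)"
    and lin: "\<And>f g a b. f \<in> L20 \<nu>' \<Longrightarrow> g \<in> L20 \<nu>' \<Longrightarrow>
      AE \<omega> in M. W' (\<lambda>x. a * f x + b * g x) \<omega> = a * W' f \<omega> + b * W' g \<omega>"
    and cov: "\<And>f g. f \<in> L20 \<nu>' \<Longrightarrow> g \<in> L20 \<nu>' \<Longrightarrow>
      (\<integral>\<omega>. W' f \<omega> * W' g \<omega> \<partial>M) = (\<integral>x. f x * g x \<partial>\<nu>')"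
    using W unfolding white_noise_def jointly_centered_gaussian_def by blast+
  have "white_noise M \<nu> W"
    unfolding white_noise_def jointly_centered_gaussian_def
  proof (intro conjI allI ballI impI)
    fix S and a :: "('b \<Rightarrow> real) \<Rightarrow> real"
    assume S: "finite S \<and> S \<subseteq> L20 \<nu>"
    let ?T = "(\<lambda>f y. f (\<psi> y)) ` S"
    have "centered_gaussian M (\<lambda>\<omega>. \<Sum>g\<in>?T. (a (\<lambda>x. g (\<phi> x)) / sqrt c) * W' g \<omega>)"
      using S by (intro gauss) (auto simp: L20_pullback_iff)
    also have "(\<lambda>\<omega>. \<Sum>g\<in>?T. (a (\<lambda>x. g (\<phi> x)) / sqrt c) * W' g \<omega>) = (\<lambda>\<omega>. \<Sum>f\<in>S. a f * W f \<omega>)"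
    proof
      fix \<omega>
      have "inj_on (\<lambda>f y. f (\<psi> y)) S"
      proof (rule inj_onI)
        fix f g :: "'b \<Rightarrow> real" assume "(\<lambda>y. f (\<psi> y)) = (\<lambda>y. g (\<psi> y))"
        then have "f (\<psi> (\<phi> x)) = g (\<psi> (\<phi> x))" for x by metis
        then show "f = g" by auto
      qed
      then show "(\<Sum>g\<in>?T. (a (\<lambda>x. g (\<phi> x)) / sqrt c) * W' g \<omega>) = (\<Sum>f\<in>S. a f * W f \<omega>)"
        by (subst sum.reindex) (auto simp: W_def)
    qed
    finally show "centered_gaussian M (\<lambda>\<omega>. \<Sum>f\<in>S. a f * W f \<omega>)" .
  next
    fix f g and a b :: real assume "f \<in> L20 \<nu>" "g \<in> L20 \<nu>"
    then have "AE \<omega> in M. W' (\<lambda>y. a * f (\<psi> y) + b * g (\<psi> y)) \<omega>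
        = a * W' (\<lambda>y. f (\<psi> y)) \<omega> + b * W' (\<lambda>y. g (\<psi> y)) \<omega>"
      by (intro lin) (auto simp: L20_pullback_iff)
    then show "AE \<omega> in M. W (\<lambda>x. a * f x + b * g x) \<omega> = a * W f \<omega> + b * W g \<omega>"
      by eventually_elim (simp add: W_def algebra_simps add_divide_distrib)
  next
    fix f g assume fg: "f \<in> L20 \<nu>" "g \<in> L20 \<nu>"
    have "(\<integral>\<omega>. W f \<omega> * W g \<omega> \<partial>M) =
        (\<integral>\<omega>. 1 / c * (W' (\<lambda>y. f (\<psi> y)) \<omega> * W' (\<lambda>y. g (\<psi> y)) \<omega>) \<partial>M)"
      using c_pos by (simp add: W_def)
    also have "\<dots> = 1 / c * (\<integral>\<omega>. W' (\<lambda>y. f (\<psi> y)) \<omega> * W' (\<lambda>y. g (\<psi> y)) \<omega> \<partial>M)"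
      by (rule integral_mult_right_zero)
    also have "(\<integral>\<omega>. W' (\<lambda>y. f (\<psi> y)) \<omega> * W' (\<lambda>y. g (\<psi> y)) \<omega> \<partial>M) = c * (\<integral>x. f x * g x \<partial>\<nu>)"
      using fg by (simp add: cov L20_pullback_iff integral_pullback[of "\<lambda>x. f x * g x"])
    finally show "(\<integral>\<omega>. W f \<omega> * W g \<omega> \<partial>M) = (\<integral>x. f x * g x \<partial>\<nu>)" using c_pos by simp
  qed
  then show ?thesis by (simp add: W_def)
qed

text \<open>
  The factor \<open>c (e/c)\<^sup>s\<close> of the Green functions and the factor \<open>1 / sqrt c\<close> of the noise
  combine, by linearity of the noise, to \<open>sqrt c (e/c)\<^sup>s\<close>.
\<close>

lemma fractional_brownian_field_pullback:
  assumes X': "fractional_brownian_field M \<nu>' D' E' H X'"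
    and mass: "measure \<nu>' (space \<nu>') = c * measure \<nu> (space \<nu>)"
  shows "fractional_brownian_field M \<nu> D E H
    (\<lambda>x \<omega>. sqrt c * (e / c) powr ((d_h + 2 * H) / (2 * d_w)) * X' (\<phi> x) \<omega>)"
proof -
  define s where "s = (d_h + 2 * H) / (2 * d_w)"
  define k where "k = c * (e / c) powr s"
  have k: "k \<noteq> 0" using c_pos e_pos by (auto simp: k_def)
  obtain p' W' where M: "prob_space M" and meas: "\<And>y. y \<in> space \<nu>' \<Longrightarrow> X' y \<in> borel_measurable M"
    and p': "heat_kernel \<nu>' D' E' p'" and W': "white_noise M \<nu>' W'"
    and G': "\<And>y. y \<in> space \<nu>' \<Longrightarrow> green \<nu>' p' s y \<in> L20 \<nu>'"
    and XW: "\<And>y. y \<in> space \<nu>' \<Longrightarrow> AE \<omega> in M. X' y \<omega> = W' (green \<nu>' p' s y) \<omega>"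
    using X' unfolding fractional_brownian_field_def Let_def s_def by blast
  define p where "p = (\<lambda>t x y. c * p' (t / (e / c)) (\<phi> x) (\<phi> y))"
  define W where "W = (\<lambda>f \<omega>. 1 / sqrt c * W' (\<lambda>y. f (\<psi> y)) \<omega>)"
  have G: "green \<nu> p s x = (\<lambda>y. k * green \<nu>' p' s (\<phi> x) (\<phi> y))" for x
    unfolding p_def k_def by (rule ext) (rule green_pullback[OF mass])
  have GL: "(\<lambda>y. green \<nu> p s x (\<psi> y)) \<in> L20 \<nu>'" if "x \<in> space \<nu>" for x
    using G'[OF measurable_space[OF \<phi>_measurable that]] k by (auto simp: G L20_def L2_cmult_iff)
  have "AE \<omega> in M. sqrt c * (e / c) powr s * X' (\<phi> x) \<omega> = W (green \<nu> p s x) \<omega>"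
    if x: "x \<in> space \<nu>" for x
  proof -
    have \<phi>x: "\<phi> x \<in> space \<nu>'" using measurable_space[OF \<phi>_measurable x] .
    show ?thesis
      using XW[OF \<phi>x] white_noise_scaleR[OF W' G'[OF \<phi>x], of k]
    proof eventually_elim
      case (elim \<omega>)
      have "W (green \<nu> p s x) \<omega> = 1 / sqrt c * (k * X' (\<phi> x) \<omega>)"
        using elim by (simp add: W_def G)
      moreover have "1 / sqrt c * k = sqrt c * (e / c) powr s"
        using c_pos by (simp add: k_def real_div_sqrt field_simps)
      ultimately show ?case by (simp only: mult.assoc[symmetric])
    qed
  qed
  moreover have "heat_kernel \<nu> D E p" unfolding p_def by (rule heat_kernel_pullback[OF p'])
  moreover have "white_noise M \<nu> W" unfolding W_def by (rule white_noise_pullback[OF W'])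
  moreover have "green \<nu> p s x \<in> L20 \<nu>" if "x \<in> space \<nu>" for x
    using GL[OF that] L20_pullback_iff by blast
  moreover have "(\<lambda>\<omega>. sqrt c * (e / c) powr s * X' (\<phi> x) \<omega>) \<in> borel_measurable M"
    if "x \<in> space \<nu>" for x
    using meas[OF measurable_space[OF \<phi>_measurable that]] by simp
  ultimately show ?thesis
    unfolding fractional_brownian_field_def Let_def s_def[symmetric] using M by blast
qed

end


section \<open>The gasket as a self-similar set\<close>

lemma F_diff: "F i x - F i y = (x - y) / 2"
  by (simp add: F_def field_simps)

lemma Fw_Nil [simp]: "Fw [] = id"
  by (simp add: Fw_def)

lemma Fw_Cons [simp]: "Fw (i # w) = F i \<circ> Fw w"
  by (simp add: Fw_def)

lemma Fw_append: "Fw (v @ w) = Fw v \<circ> Fw w"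
  by (induction v) (auto simp: o_assoc)

lemma Fw_diff: "Fw w x - Fw w y = (x - y) / 2 ^ length w"
  by (induction w) (auto simp: F_diff)

lemma dist_Fw: "dist (Fw w x) (Fw w y) = dist x y / 2 ^ length w"
  by (simp add: dist_norm Fw_diff norm_divide norm_power)

lemma inj_Fw: "inj (Fw w)"
proof (rule injI)
  fix x y assume "Fw w x = Fw w y"
  then have "dist (Fw w x) (Fw w y) = 0" by simp
  then show "x = y" by (simp add: dist_Fw)
qed

lemma inj_F: "inj (F i)"
  using inj_Fw[of "[i]"] by simp

lemma surj_Fw: "surj (Fw w)"
proof (induction w)
  case (Cons i w)
  have "surj (F i)"
    by (rule surjI[of _ "\<lambda>z. 2 * z - q (i - 1)"]) (simp add: F_def field_simps)
  then show ?case using Cons comp_surj[of "Fw w" "F i"] by simp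
qed simp

lemma continuous_on_Fw: "continuous_on A (Fw w)"
proof (induction w)
  case (Cons i w)
  then show ?case unfolding Fw_Cons o_def F_def by (intro continuous_intros) auto
qed (simp add: id_def)

lemma continuous_on_inv_Fw: "continuous_on A (inv (Fw w))"
proof -
  have "dist (inv (Fw w) x) (inv (Fw w) y) \<le> 2 ^ length w * dist x y" for x y
    using dist_Fw[of w "inv (Fw w) x" "inv (Fw w) y"]
    by (simp add: surj_f_inv_f[OF surj_Fw] field_simps)
  then have "(2 ^ length w)-lipschitz_on A (inv (Fw w))"
    by (intro lipschitz_onI) auto
  then show ?thesis by (rule lipschitz_on_continuous_on)
qed

lemma words_0: "words 0 = {[]}"
  by (auto simp: words_def)

lemma words_eq_lists: "words n = {w. set w \<subseteq> {1, 2, 3} \<and> length w = n}"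
  by (auto simp: words_def)

lemma finite_words [simp]: "finite (words n)"
  unfolding words_eq_lists by (rule finite_lists_length_eq) simp

lemma card_words: "card (words n) = 3 ^ n"
  unfolding words_eq_lists by (subst card_lists_length_eq) (auto simp: numeral_3_eq_3)

lemma words_append: "v \<in> words m \<Longrightarrow> w \<in> words n \<Longrightarrow> v @ w \<in> words (m + n)"
  by (auto simp: words_def)

lemma words_Suc_snoc: "words (Suc n) = (\<lambda>(v, i). v @ [i]) ` (words n \<times> {1, 2, 3})"
proof
  show "words (Suc n) \<subseteq> (\<lambda>(v, i). v @ [i]) ` (words n \<times> {1, 2, 3})"
  proof
    fix w assume w: "w \<in> words (Suc n)"
    then have "w \<noteq> []" by (auto simp: words_def)
    then obtain v i where "w = v @ [i]" by (metis rev_exhaust)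
    then show "w \<in> (\<lambda>(v, i). v @ [i]) ` (words n \<times> {1, 2, 3})"
      using w by (intro image_eqI[of _ _ "(v, i)"]) (auto simp: words_def)
  qed
qed (auto simp: words_def)

definition self_similar :: "complex set \<Rightarrow> bool" where
  "self_similar K \<longleftrightarrow> compact K \<and> K \<noteq> {} \<and> K = (\<Union>i\<in>{1, 2, 3}. F i ` K)"

lemma self_similar_words:
  assumes "self_similar K"
  shows "K = (\<Union>w\<in>words n. Fw w ` K)"
proof (induction n)
  case 0
  show ?case by (simp add: words_0)
next
  case (Suc n)
  have "(\<Union>w\<in>words (Suc n). Fw w ` K) = (\<Union>v\<in>words n. Fw v ` (\<Union>i\<in>{1, 2, 3}. F i ` K))"
    by (force simp: words_Suc_snoc Fw_append)
  also have "(\<Union>i\<in>{1, 2, 3}. F i ` K) = K" using assms by (simp add: self_similar_def)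
  finally show ?case using Suc by simp
qed

text \<open>
  A point of \<open>K\<close> lies in \<open>F\<^sub>w(K)\<close> for some word \<open>w\<close> of any given length \<open>n\<close>, hence at a distance of
  order \<open>2\<^sup>-\<^sup>n\<close> from the subset \<open>F\<^sub>w(L)\<close> of the closed set \<open>L\<close>. By symmetry there is at most one
  self-similar set.
\<close>

lemma self_similar_subset:
  assumes K: "self_similar K" and L: "self_similar L"
  shows "K \<subseteq> L"
proof
  fix x assume x: "x \<in> K"
  obtain l where l: "l \<in> L" using L by (auto simp: self_similar_def)
  have "bounded (K \<union> L)"
    using K L by (simp add: self_similar_def compact_imp_bounded)
  then obtain B where B: "\<And>a b. a \<in> K \<union> L \<Longrightarrow> b \<in> K \<union> L \<Longrightarrow> dist a b \<le> B"
    by (metis bounded_two_points)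
  have "x \<in> closure L"
    unfolding closure_approachable
  proof (intro allI impI)
    fix \<epsilon> :: real assume \<epsilon>: "\<epsilon> > 0"
    obtain n where n: "B / \<epsilon> < 2 ^ n" using real_arch_pow[of 2 "B / \<epsilon>"] by auto
    have "x \<in> (\<Union>w\<in>words n. Fw w ` K)"
      using x self_similar_words[OF K, of n] by blast
    then obtain w k where w: "w \<in> words n" "k \<in> K" "x = Fw w k" by blast
    have "Fw w l \<in> (\<Union>w\<in>words n. Fw w ` L)" using l w by blast
    then have wl: "Fw w l \<in> L" using self_similar_words[OF L, of n] by blast
    have "dist (Fw w l) x = dist l k / 2 ^ n" using w by (simp add: dist_Fw words_def)
    also have "\<dots> \<le> B / 2 ^ n" using B[of l k] l w by (simp add: divide_right_mono)
    also have "\<dots> < \<epsilon>" using n \<epsilon> by (simp add: field_simps)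
    finally show "\<exists>y\<in>L. dist y x < \<epsilon>" using wl by blast
  qed
  then show "x \<in> L" using L by (simp add: self_similar_def compact_imp_closed)
qed

text \<open>
  The closed unit disc is mapped into itself by the three contractions, so its iterated images
  decrease to a compact set. A point of the intersection lies, for one fixed \<open>i\<close>, in the image
  under \<open>F i\<close> of all the iterates, since otherwise it would leave all three images from some
  stage on; as \<open>F i\<close> is injective, its preimage is in the intersection again.
\<close>

lemma self_similar_exists: "\<exists>K. self_similar K"
proof -
  define \<Phi> where "\<Phi> A = (\<Union>i\<in>{1, 2, 3}. F i ` A)" for A
  define T where "T n = (\<Phi> ^^ n) (cball 0 1)" for n
  have T_0: "T 0 = cball 0 1" and T_Suc: "T (Suc n) = \<Phi> (T n)" for n by (simp_all add: T_def)
  have \<Phi>_mono: "A \<subseteq> B \<Longrightarrow> \<Phi> A \<subseteq> \<Phi> B" for A B by (auto simp: \<Phi>_def)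
  have q: "norm (q i) \<le> 1" for i by (simp add: q_def)
  have "norm (F i z) \<le> 1" if "norm z \<le> 1" for i z
  proof -
    have "F i z = (z + q (i - 1)) / 2" by (simp add: F_def field_simps)
    then have "norm (F i z) = norm (z + q (i - 1)) / 2"
      by (simp only: norm_divide norm_numeral)
    also have "norm (z + q (i - 1)) \<le> norm z + norm (q (i - 1))" by (rule norm_triangle_ineq)
    finally show ?thesis using that q[of "i - 1"] by simp
  qed
  then have T1: "T 1 \<subseteq> T 0" by (auto simp: T_0 T_Suc \<Phi>_def)
  have step: "T (Suc n) \<subseteq> T n" for n
    by (induction n) (use T1 in \<open>auto simp: T_Suc intro: \<Phi>_mono[THEN subsetD]\<close>)
  have anti: "m \<le> n \<Longrightarrow> T n \<subseteq> T m" for m n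
    by (rule lift_Suc_antimono_le[of T]) (use step in auto)
  have cont: "continuous_on A (F i)" for A i using continuous_on_Fw[of A "[i]"] by simp
  have comp: "compact (T n)" for n
    by (induction n) (auto simp: T_0 T_Suc \<Phi>_def intro!: compact_Un compact_continuous_image cont)
  have ne: "T n \<noteq> {}" for n
    by (induction n) (auto simp: T_0 T_Suc \<Phi>_def)
  define K where "K = (\<Inter>n. T n)"
  have "compact K" unfolding K_def by (rule compact_Inter) (use comp in auto)
  moreover have "K \<noteq> {}" unfolding K_def by (rule compact_nest[OF comp ne anti])
  moreover have "\<Phi> K \<subseteq> K"
  proof -
    have "\<Phi> K \<subseteq> T n" for n
    proof -
      have "\<Phi> K \<subseteq> T (Suc n)" unfolding T_Suc by (rule \<Phi>_mono) (auto simp: K_def)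
      then show ?thesis using step by blast
    qed
    then show ?thesis unfolding K_def by blast
  qed
  moreover have "K \<subseteq> \<Phi> K"
  proof
    fix x assume x: "x \<in> K"
    have "\<exists>i\<in>{1, 2, 3}. \<forall>n. x \<in> F i ` T n"
    proof (rule ccontr)
      assume "\<not> ?thesis"
      then obtain n where n: "\<And>i. i \<in> {1, 2, 3} \<Longrightarrow> x \<notin> F i ` T (n i)" by metis
      define N where "N = max (n 1) (max (n 2) (n 3))"
      have "x \<notin> F i ` T N" if "i \<in> {1, 2, 3}" for i
      proof -
        have "n i \<le> N" using that by (auto simp: N_def)
        then have "F i ` T N \<subseteq> F i ` T (n i)" by (intro image_mono anti)
        then show ?thesis using n[OF that] by blast
      qed
      moreover have "x \<in> \<Phi> (T N)" using x unfolding K_def T_Suc[symmetric] by blast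
      ultimately show False unfolding \<Phi>_def by blast
    qed
    then obtain i where i: "i \<in> {1, 2, 3}" "\<And>n. x \<in> F i ` T n" by blast
    then obtain y where y: "x = F i y" by blast
    have "y \<in> T n" for n using i(2)[of n] y inj_F[of i] by (auto dest: injD)
    then show "x \<in> \<Phi> K" using i(1) y by (auto simp: \<Phi>_def K_def)
  qed
  ultimately have "self_similar K" unfolding self_similar_def \<Phi>_def by blast
  then show ?thesis ..
qed

lemma self_similar_gasket: "self_similar gasket"
proof -
  have "\<exists>!K. self_similar K"
    using self_similar_exists self_similar_subset by (metis subset_antisym)
  from theI'[OF this] show ?thesis by (simp add: gasket_def self_similar_def)
qed

lemma compact_gasket: "compact gasket" and gasket_eq_cells: "gasket = (\<Union>w\<in>words n. cell w)"
  using self_similar_gasket self_similar_words[OF self_similar_gasket]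
  by (simp_all add: self_similar_def cell_def)

lemma cell_subset_gasket: "w \<in> words n \<Longrightarrow> cell w \<subseteq> gasket"
  using gasket_eq_cells[of n] by blast

lemma closed_cell: "closed (cell w)"
  unfolding cell_def
  by (intro compact_imp_closed compact_continuous_image continuous_on_Fw compact_gasket)

lemma cell_append: "cell (v @ w) = Fw v ` cell w"
  by (simp add: cell_def Fw_append image_comp)

section \<open>The measure is determined by its values on cells\<close>

lemma space_gasket_measure:
  assumes "gasket_measure \<mu>"
  shows "space \<mu> = gasket"
  using assms sets_eq_imp_space_eq[of \<mu> "restrict_space borel gasket"]
  by (simp add: gasket_measure_def space_restrict_space)

lemma sets_gasket_measure_iff:
  assumes "gasket_measure \<mu>"
  shows "A \<in> sets \<mu> \<longleftrightarrow> A \<subseteq> gasket \<and> A \<in> sets borel"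
  using assms compact_imp_closed[OF compact_gasket]
  by (simp add: gasket_measure_def sets_restrict_space_iff)

lemma cell_in_sets:
  assumes "gasket_measure \<mu>" "w \<in> words n"
  shows "cell w \<in> sets \<mu>"
  using assms cell_subset_gasket closed_cell by (simp add: sets_gasket_measure_iff)

lemma emeasure_gasket:
  assumes "gasket_measure \<mu>"
  shows "emeasure \<mu> gasket = 1"
proof -
  have "emeasure \<mu> (cell []) = ennreal ((1/3) ^ 0)"
    using assms words_0 unfolding gasket_measure_def by blast
  then show ?thesis by (simp add: cell_def)
qed

text \<open>
  The cells of a given level overlap in null sets, which follows by counting alone: they cover the
  gasket and their measures add up to its total mass, so a union of some of them cannot have less
  measure than its share without the complementary union having more than its own.
\<close>

lemma measure_Union_cells:
  assumes \<mu>: "gasket_measure \<mu>" and S: "S \<subseteq> words n"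
  shows "measure \<mu> (\<Union>w\<in>S. cell w) = card S / 3 ^ n"
proof -
  have sets: "cell w \<in> sets \<mu>" if "w \<in> words n" for w using cell_in_sets[OF \<mu> that] .
  interpret finite_measure \<mu>
    by (rule finite_measureI) (simp add: space_gasket_measure[OF \<mu>] emeasure_gasket[OF \<mu>])
  have cell: "measure \<mu> (cell w) = 1 / 3 ^ n" if "w \<in> words n" for w
    using \<mu> that unfolding gasket_measure_def measure_def by (simp add: power_one_over)
  have le: "measure \<mu> (\<Union>w\<in>R. cell w) \<le> card R / 3 ^ n" if "R \<subseteq> words n" for R
  proof -
    have fin: "finite R" using finite_subset[OF that finite_words] .
    have "measure \<mu> (\<Union>w\<in>R. cell w) \<le> (\<Sum>w\<in>R. measure \<mu> (cell w))"
      by (rule finite_measure_subadditive_finite) (use fin that sets in auto)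
    also have "\<dots> = (\<Sum>w\<in>R. 1 / 3 ^ n)" using that cell by (intro sum.cong) auto
    finally show ?thesis by simp
  qed
  let ?R = "words n - S"
  have meas: "(\<Union>w\<in>R. cell w) \<in> sets \<mu>" if "R \<subseteq> words n" for R
    using that sets finite_subset[OF that finite_words] by (intro sets.finite_UN) auto
  have "gasket = (\<Union>w\<in>S. cell w) \<union> (\<Union>w\<in>?R. cell w)"
    using gasket_eq_cells[of n] S by blast
  then have "1 = measure \<mu> ((\<Union>w\<in>S. cell w) \<union> (\<Union>w\<in>?R. cell w))"
    using emeasure_gasket[OF \<mu>] by (simp add: measure_def)
  also have "\<dots> \<le> measure \<mu> (\<Union>w\<in>S. cell w) + measure \<mu> (\<Union>w\<in>?R. cell w)"
    using meas[OF S] meas[of ?R] by (intro measure_Un_le) auto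
  also have "measure \<mu> (\<Union>w\<in>?R. cell w) \<le> card ?R / 3 ^ n" by (rule le) auto
  also have "card ?R / 3 ^ n = 1 - card S / 3 ^ n"
  proof -
    have "card S + card ?R = 3 ^ n"
      using card_Diff_subset[OF finite_subset[OF S finite_words] S] card_mono[OF finite_words S]
      by (simp add: card_words)
    then have "real (card S) + real (card ?R) = 3 ^ n"
      by (metis of_nat_add of_nat_numeral of_nat_power)
    then show ?thesis by (simp add: field_simps)
  qed
  finally show ?thesis using le[OF S] by simp
qed

text \<open>
  The cells of level \<open>n\<close> that meet \<open>C\<close> have diameters of order \<open>2\<^sup>-\<^sup>n\<close>, so their unions decrease to
  the part of the closed set \<open>C\<close> in the gasket.
\<close>

lemma measure_closed_LIMSEQ:
  assumes \<mu>: "gasket_measure \<mu>" and C: "closed C"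
  shows "(\<lambda>n. card {w \<in> words n. cell w \<inter> C \<noteq> {}} / 3 ^ n) \<longlonglongrightarrow> measure \<mu> (C \<inter> gasket)"
proof -
  interpret finite_measure \<mu>
    by (rule finite_measureI) (simp add: space_gasket_measure[OF \<mu>] emeasure_gasket[OF \<mu>])
  define U where "U n = (\<Union>w\<in>{w \<in> words n. cell w \<inter> C \<noteq> {}}. cell w)" for n
  have meas: "U n \<in> sets \<mu>" for n
    unfolding U_def using cell_in_sets[OF \<mu>] by (intro sets.finite_UN) auto
  have "U (Suc n) \<subseteq> U n" for n
  proof
    fix x assume "x \<in> U (Suc n)"
    then obtain w where w: "w \<in> words (Suc n)" "cell w \<inter> C \<noteq> {}" "x \<in> cell w"
      unfolding U_def by blast
    from w(1) obtain v i where v: "v \<in> words n" "i \<in> {1, 2, 3}" "w = v @ [i]"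
      unfolding words_Suc_snoc by auto
    have "[i] \<in> words 1" using v(2) by (simp add: words_def)
    then have "cell (v @ [i]) \<subseteq> cell v"
      unfolding cell_append cell_def[of v] by (intro image_mono cell_subset_gasket)
    then show "x \<in> U n" using v w unfolding U_def by blast
  qed
  then have "decseq U" by (rule decseq_SucI)
  have "(\<lambda>n. measure \<mu> (U n)) \<longlonglongrightarrow> measure \<mu> (\<Inter>n. U n)"
    by (rule finite_Lim_measure_decseq) (use meas \<open>decseq U\<close> in auto)
  moreover have "(\<Inter>n. U n) = C \<inter> gasket"
  proof
    show "C \<inter> gasket \<subseteq> (\<Inter>n. U n)"
    proof (intro subsetI INT_I)
      fix x n assume "x \<in> C \<inter> gasket"
      then show "x \<in> U n" using gasket_eq_cells[of n] unfolding U_def by blast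
    qed
    show "(\<Inter>n. U n) \<subseteq> C \<inter> gasket"
    proof
      fix x assume x: "x \<in> (\<Inter>n. U n)"
      then have "x \<in> U 0" by blast
      then have "x \<in> gasket" unfolding U_def using cell_subset_gasket by blast
      obtain B where B: "\<And>a b. a \<in> gasket \<Longrightarrow> b \<in> gasket \<Longrightarrow> dist a b \<le> B"
        using compact_imp_bounded[OF compact_gasket] by (metis bounded_two_points)
      have "x \<in> closure C"
        unfolding closure_approachable
      proof (intro allI impI)
        fix \<epsilon> :: real assume \<epsilon>: "\<epsilon> > 0"
        obtain n where n: "B / \<epsilon> < 2 ^ n" using real_arch_pow[of 2 "B / \<epsilon>"] by auto
        have "x \<in> U n" using x by blast
        then obtain w y where w: "w \<in> words n" "x \<in> cell w" "y \<in> cell w" "y \<in> C"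
          unfolding U_def by blast
        then obtain a b where ab: "a \<in> gasket" "b \<in> gasket" "x = Fw w a" "y = Fw w b"
          unfolding cell_def by blast
        have "dist y x = dist b a / 2 ^ n" using ab w(1) by (simp add: dist_Fw words_def)
        also have "\<dots> \<le> B / 2 ^ n" using B[of b a] ab by (simp add: divide_right_mono)
        also have "\<dots> < \<epsilon>" using n \<epsilon> by (simp add: field_simps)
        finally show "\<exists>y\<in>C. dist y x < \<epsilon>" using w(4) by blast
      qed
      then show "x \<in> C \<inter> gasket" using C \<open>x \<in> gasket\<close> by simp
    qed
  qed
  moreover have "measure \<mu> (U n) = card {w \<in> words n. cell w \<inter> C \<noteq> {}} / 3 ^ n" for n
    unfolding U_def by (rule measure_Union_cells[OF \<mu>]) auto
  ultimately show ?thesis by simp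
qed

text \<open>
  The preceding formula expresses the measure of a closed set by numbers of cells, and closed
  sets form an intersection-stable generator of the Borel sets.
\<close>

lemma gasket_measure_unique:
  assumes \<mu>: "gasket_measure \<mu>" and \<rho>: "gasket_measure \<rho>"
  shows "\<mu> = \<rho>"
proof -
  let ?B = "\<lambda>\<mu>. distr \<mu> borel (\<lambda>x::complex. x)"
  have meas: "(\<lambda>x. x) \<in> borel_measurable m" if "gasket_measure m" for m :: "complex measure"
  proof -
    have "(\<lambda>x. x) \<in> borel_measurable (restrict_space borel gasket)"
      by (rule measurable_restrict_space1) simp
    then show ?thesis using that unfolding gasket_measure_def
      by (metis measurable_cong_sets)
  qed
  have B: "emeasure (?B m) A = emeasure m (A \<inter> gasket)"
    if "gasket_measure m" "A \<in> sets borel" for m A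
    using that meas by (simp add: emeasure_distr space_gasket_measure)
  have fin: "emeasure m A \<noteq> \<infinity>" if "gasket_measure m" for m A
  proof -
    have "emeasure m A \<le> emeasure m (space m)" by (rule emeasure_space)
    then show ?thesis using that
      by (auto simp: space_gasket_measure emeasure_gasket top_unique)
  qed
  have eq: "?B \<mu> = ?B \<rho>"
  proof (rule measure_eqI_generator_eq[where \<Omega> = UNIV and E = "Collect closed" and A = "\<lambda>_. UNIV"])
    fix C :: "complex set" assume "C \<in> Collect closed"
    then have C: "closed C" by simp
    have "measure \<mu> (C \<inter> gasket) = measure \<rho> (C \<inter> gasket)"
      using LIMSEQ_unique[OF measure_closed_LIMSEQ[OF \<mu> C] measure_closed_LIMSEQ[OF \<rho> C]] .
    then have "emeasure \<mu> (C \<inter> gasket) = emeasure \<rho> (C \<inter> gasket)"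
      using fin[OF \<mu>] fin[OF \<rho>] by (simp add: emeasure_eq_ennreal_measure)
    then show "emeasure (?B \<mu>) C = emeasure (?B \<rho>) C"
      using B[OF \<mu>] B[OF \<rho>] C by simp
  next
    show "emeasure (?B \<mu>) UNIV \<noteq> \<infinity>" for i :: nat
      using B[OF \<mu>, of UNIV] fin[OF \<mu>] by simp
  qed (auto simp: Int_stable_def borel_eq_closed)
  show ?thesis
  proof (rule measure_eqI)
    show "sets \<mu> = sets \<rho>" using \<mu> \<rho> by (simp add: gasket_measure_def)
    fix A assume "A \<in> sets \<mu>"
    then have A: "A \<in> sets borel" "A \<inter> gasket = A"
      using sets_gasket_measure_iff[OF \<mu>] by auto
    then show "emeasure \<mu> A = emeasure \<rho> A"
      using B[OF \<mu> A(1)] B[OF \<rho> A(1)] eq by simp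
  qed
qed

lemma Fw_measurable:
  assumes \<mu>: "gasket_measure \<mu>" and w: "w \<in> words n"
  shows "Fw w \<in> measurable \<mu> (restrict_space \<mu> (cell w))"
    and "inv (Fw w) \<in> measurable (restrict_space \<mu> (cell w)) \<mu>"
proof -
  have sets: "sets \<mu> = sets (restrict_space borel gasket)" using \<mu> by (simp add: gasket_measure_def)
  have cont: "f \<in> borel_measurable \<mu>" if "continuous_on UNIV f" for f :: "complex \<Rightarrow> complex"
    using measurable_restrict_space1[OF borel_measurable_continuous_onI[OF that], of gasket]
      measurable_cong_sets[OF sets refl] by blast
  have into: "f \<in> measurable m \<mu>" if "f \<in> borel_measurable m" "f \<in> space m \<rightarrow> gasket"
    for f :: "complex \<Rightarrow> complex" and m :: "complex measure"
    using measurable_restrict_space2[OF that(2,1)] measurable_cong_sets[OF refl sets] by blast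
  have sub: "cell w \<subseteq> gasket" by (rule cell_subset_gasket[OF w])
  show "Fw w \<in> measurable \<mu> (restrict_space \<mu> (cell w))"
    using sub by (intro measurable_restrict_space2 into cont continuous_on_Fw)
      (auto simp: space_gasket_measure[OF \<mu>] cell_def)
  show "inv (Fw w) \<in> measurable (restrict_space \<mu> (cell w)) \<mu>"
    using inj_Fw[of w] by (intro into measurable_restrict_space1 cont continuous_on_inv_Fw)
      (auto simp: space_restrict_space cell_def)
qed

text \<open>
  Pulled back by \<open>F\<^sub>w\<close> and multiplied by \<open>3\<^sup>n\<close>, the measure on the cell gives \<open>3\<^sup>-\<^sup>k\<close> to each cell of
  level \<open>k\<close>, because \<open>F\<^sub>w\<close> maps the cell of \<open>v\<close> onto the cell of \<open>w @ v\<close>. By uniqueness it is \<open>\<mu>\<close>.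
\<close>

lemma distr_inv_Fw:
  assumes \<mu>: "gasket_measure \<mu>" and w: "w \<in> words n"
  shows "distr (restrict_space \<mu> (cell w)) \<mu> (inv (Fw w)) = density \<mu> (\<lambda>_. ennreal ((1/3) ^ n))"
proof -
  let ?\<nu> = "restrict_space \<mu> (cell w)"
  note meas = Fw_measurable[OF \<mu> w]
  define \<rho> where "\<rho> = density (distr ?\<nu> \<mu> (inv (Fw w))) (\<lambda>_. ennreal (3 ^ n))"
  have sets_\<rho>: "sets \<rho> = sets \<mu>" by (simp add: \<rho>_def)
  have space: "space ?\<nu> = cell w"
    using cell_subset_gasket[OF w] by (auto simp: space_restrict_space space_gasket_measure[OF \<mu>])
  have \<rho>: "emeasure \<rho> A = ennreal (3 ^ n) * emeasure \<mu> (Fw w ` A)" if A: "A \<in> sets \<mu>" for A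
  proof -
    have sub: "A \<subseteq> gasket" using A sets_gasket_measure_iff[OF \<mu>] by simp
    have pre: "inv (Fw w) -` A \<inter> space ?\<nu> = Fw w ` A"
      unfolding space using sub inj_Fw[of w] by (auto simp: cell_def)
    have "emeasure \<rho> A = ennreal (3 ^ n) * emeasure ?\<nu> (Fw w ` A)"
      using A meas(2) by (simp add: \<rho>_def emeasure_density_const emeasure_distr pre)
    also have "emeasure ?\<nu> (Fw w ` A) = emeasure \<mu> (Fw w ` A)"
      using cell_in_sets[OF \<mu> w] sub by (intro emeasure_restrict_space) (auto simp: cell_def)
    finally show ?thesis .
  qed
  have pow: "ennreal (3 ^ n) * ennreal ((1/3) ^ (n + k)) = ennreal ((1/3) ^ k)" for k
    by (simp add: ennreal_mult[symmetric] power_add power_one_over)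
  have "gasket_measure \<rho>"
    unfolding gasket_measure_def
  proof (intro conjI allI ballI)
    show "sets \<rho> = sets (restrict_space borel gasket)"
      using \<mu> by (simp add: sets_\<rho> gasket_measure_def)
    fix k v assume v: "v \<in> words k"
    have "emeasure \<rho> (cell v) = ennreal (3 ^ n) * emeasure \<mu> (cell (w @ v))"
      using \<rho>[OF cell_in_sets[OF \<mu> v]] by (simp add: cell_append)
    also have "emeasure \<mu> (cell (w @ v)) = ennreal ((1/3) ^ (n + k))"
      using \<mu> words_append[OF w v] unfolding gasket_measure_def by blast
    finally show "emeasure \<rho> (cell v) = ennreal ((1/3) ^ k)" unfolding pow .
  qed
  then have \<rho>_eq: "\<rho> = \<mu>" by (rule gasket_measure_unique) (rule \<mu>)
  show ?thesis
  proof (rule measure_eqI)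
    fix A assume "A \<in> sets (distr ?\<nu> \<mu> (inv (Fw w)))"
    then have A: "A \<in> sets \<mu>" by simp
    have "emeasure (density \<mu> (\<lambda>_. ennreal ((1/3) ^ n))) A = ennreal ((1/3) ^ n) * emeasure \<rho> A"
      using A by (simp add: emeasure_density_const \<rho>_eq)
    also have "\<dots> = ennreal ((1/3) ^ n) * (ennreal (3 ^ n) * emeasure (distr ?\<nu> \<mu> (inv (Fw w))) A)"
      using A by (simp add: \<rho>_def emeasure_density_const)
    also have "\<dots> = emeasure (distr ?\<nu> \<mu> (inv (Fw w))) A"
      using pow[of 0] by (simp add: mult.assoc[symmetric] mult.commute)
    finally show "emeasure (distr ?\<nu> \<mu> (inv (Fw w))) A = emeasure (density \<mu> (\<lambda>_. ennreal ((1/3) ^ n))) A"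
      by simp
  qed simp
qed


section \<open>Monotonicity of the level energies\<close>

lemma q_distinct: "q 0 \<noteq> q 1" "q 0 \<noteq> q 2" "q 1 \<noteq> q 2"
proof -
  have "Im (cis (pi / 3)) = sqrt 3 / 2" unfolding cis.sel by (rule sin_60)
  then have "Im (cis (pi / 3)) \<noteq> 0" by (simp only:) simp
  then have "cis (pi / 3) \<noteq> 0" "cis (pi / 3) \<noteq> 1"
    by (metis zero_complex.sel(2)) (metis \<open>Im (cis (pi / 3)) \<noteq> 0\<close> one_complex.sel(2))
  then show "q 0 \<noteq> q 1" "q 0 \<noteq> q 2" "q 1 \<noteq> q 2" by (auto simp: q_def)
qed

lemma sum_V0: "(\<Sum>x\<in>V0. h x) = h (q 0) + h (q 1) + (h (q 2) :: real)"
  unfolding V0_def using q_distinct by (simp add: add.assoc)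

lemma F_vertices:
  "F 1 (q 0) = q 0" "F 2 (q 1) = q 1" "F 3 (q 2) = q 2"
  "F 2 (q 0) = F 1 (q 1)" "F 3 (q 0) = F 1 (q 2)" "F 3 (q 1) = F 2 (q 2)"
  by (simp_all add: F_def q_def field_simps)

text \<open>
  With \<open>a, b, c\<close> at the corners of a triangle, the energy of the values \<open>x, y, z\<close> at the
  midpoints of its sides is smallest at the harmonic extension
  \<open>x = (2a + 2b + c) / 5\<close> and so on, where it is \<open>3/5\<close> of the energy of the corner values;
  the excess is a positive quadratic form in the deviations from that extension.
\<close>

lemma harmonic_extension_inequality:
  fixes a b c x y z :: real
  shows "(a - b)\<^sup>2 + (a - c)\<^sup>2 + (b - c)\<^sup>2 \<le> 5/3 *
    (((a - x)\<^sup>2 + (a - z)\<^sup>2 + (x - z)\<^sup>2) + ((x - b)\<^sup>2 + (x - y)\<^sup>2 + (b - y)\<^sup>2) +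
     ((z - y)\<^sup>2 + (z - c)\<^sup>2 + (y - c)\<^sup>2))"
proof -
  define u v w where "u = x - (2 * a + 2 * b + c) / 5" and "v = y - (a + 2 * b + 2 * c) / 5"
    and "w = z - (2 * a + b + 2 * c) / 5"
  have x: "x = u + (2 * a + 2 * b + c) / 5" and y: "y = v + (a + 2 * b + 2 * c) / 5"
    and z: "z = w + (2 * a + b + 2 * c) / 5"
    by (simp_all add: u_def v_def w_def)
  have "5/3 * (((a - x)\<^sup>2 + (a - z)\<^sup>2 + (x - z)\<^sup>2) + ((x - b)\<^sup>2 + (x - y)\<^sup>2 + (b - y)\<^sup>2) +
      ((z - y)\<^sup>2 + (z - c)\<^sup>2 + (y - c)\<^sup>2)) - ((a - b)\<^sup>2 + (a - c)\<^sup>2 + (b - c)\<^sup>2)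
    = 5/3 * (2 * u\<^sup>2 + 2 * v\<^sup>2 + 2 * w\<^sup>2 + (u - v)\<^sup>2 + (v - w)\<^sup>2 + (u - w)\<^sup>2)"
    unfolding x y z by (simp add: power2_eq_square field_simps)
  also have "\<dots> \<ge> 0" by simp
  finally show ?thesis by simp
qed

lemma words_Suc_sum: "(\<Sum>j\<in>words (Suc n). h j) = (\<Sum>v\<in>words n. \<Sum>i\<in>{1, 2, 3}. (h (v @ [i]) :: real))"
proof -
  have inj: "inj_on (\<lambda>(v, i). v @ [i]) (words n \<times> {1, 2, 3})" by (auto simp: inj_on_def)
  show ?thesis
    unfolding words_Suc_snoc sum.reindex[OF inj] sum.cartesian_product o_def
    by (simp only: case_prod_unfold)
qed

text \<open>
  Passing from level \<open>m\<close> to level \<open>m + 1\<close> adds the midpoints of the sides in each triangle of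
  level \<open>m\<close>; the factor \<open>5/3\<close> compensates exactly for the smallest energy these can have.
\<close>

lemma gasket_energy_level_mono:
  "gasket_energy_level m f f \<le> gasket_energy_level (Suc m) f f"
proof -
  define T where "T g = (\<Sum>x\<in>V0. \<Sum>y\<in>V0. (g x - g y) * (g x - g y :: real))" for g
  have T: "T g = 2 * ((g (q 0) - g (q 1))\<^sup>2 + (g (q 0) - g (q 2))\<^sup>2 + (g (q 1) - g (q 2))\<^sup>2)" for g
    unfolding T_def sum_V0 by (simp add: power2_eq_square algebra_simps)
  have "T (\<lambda>x. f (Fw v x)) \<le> 5/3 * (\<Sum>i\<in>{1, 2, 3}. T (\<lambda>x. f (Fw (v @ [i]) x)))" for v
  proof -
    define g where "g x = f (Fw v x)" for x
    have "T g \<le> 5/3 * (T (\<lambda>x. g (F 1 x)) + T (\<lambda>x. g (F 2 x)) + T (\<lambda>x. g (F 3 x)))"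
      using harmonic_extension_inequality[of "g (q 0)" "g (q 1)" "g (q 2)"
          "g (F 1 (q 1))" "g (F 1 (q 2))" "g (F 2 (q 2))"]
      unfolding T F_vertices by argo
    then show ?thesis by (simp add: g_def[abs_def] Fw_append add.assoc)
  qed
  then have "(\<Sum>v\<in>words m. T (\<lambda>x. f (Fw v x)))
      \<le> (\<Sum>v\<in>words m. 5/3 * (\<Sum>i\<in>{1, 2, 3}. T (\<lambda>x. f (Fw (v @ [i]) x))))"
    by (rule sum_mono)
  also have "\<dots> = 5/3 * (\<Sum>j\<in>words (Suc m). T (\<lambda>x. f (Fw j x)))"
    unfolding words_Suc_sum by (simp add: sum_distrib_left)
  finally have "1/2 * (5/3) ^ m * (\<Sum>v\<in>words m. T (\<lambda>x. f (Fw v x)))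
      \<le> 1/2 * (5/3) ^ m * (5/3 * (\<Sum>j\<in>words (Suc m). T (\<lambda>x. f (Fw j x))))"
    by (rule mult_left_mono) simp
  then show ?thesis unfolding gasket_energy_level_def T_def[symmetric] by (simp add: mult_ac)
qed

lemma gasket_energy_level_add_scaled:
  "gasket_energy_level m (\<lambda>x. f x + c * g x) (\<lambda>x. f x + c * g x) =
    gasket_energy_level m f f + 2 * c * gasket_energy_level m f g + c\<^sup>2 * gasket_energy_level m g g"
proof -
  let ?S = "\<lambda>h. \<Sum>j\<in>words m. \<Sum>x\<in>V0. \<Sum>y\<in>V0. (h j x y :: real)"
  let ?d = "\<lambda>f j x y. f (Fw j x) - f (Fw j y) :: real"
  have dist: "?S (\<lambda>j x y. h j x y + b * k j x y) = ?S h + b * ?S k" for h k b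
    by (simp add: sum.distrib sum_distrib_left)
  have expand: "?S (\<lambda>j x y. ?d (\<lambda>x. f x + c * g x) j x y * ?d (\<lambda>x. f x + c * g x) j x y)
      = ?S (\<lambda>j x y. ?d f j x y * ?d f j x y) + 2 * c * ?S (\<lambda>j x y. ?d f j x y * ?d g j x y)
        + c\<^sup>2 * ?S (\<lambda>j x y. ?d g j x y * ?d g j x y)"
    unfolding dist[symmetric] by (intro sum.cong refl) (simp add: power2_eq_square algebra_simps)
  have ring: "k * (A + 2 * c * B + c\<^sup>2 * C) = k * A + 2 * c * (k * B) + c\<^sup>2 * (k * C)" for k A B C
    by (simp add: algebra_simps)
  show ?thesis unfolding gasket_energy_level_def expand by (rule ring)
qed

lemma gasket_energy_level_nonneg: "0 \<le> gasket_energy_level m f f"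
  unfolding gasket_energy_level_def by (intro mult_nonneg_nonneg sum_nonneg zero_le_square) auto

text \<open>
  The polarised form is a \<open>lim\<close>, which is an unspecified number where the level energies
  diverge; the scaling relation between the forms therefore rests on this convergence. The
  energies of \<open>f + g\<close> increase, and they are bounded because those of \<open>f - g\<close> are nonnegative.
\<close>

lemma convergent_gasket_energy_level:
  assumes f: "convergent (\<lambda>m. gasket_energy_level m f f)"
    and g: "convergent (\<lambda>m. gasket_energy_level m g g)"
  shows "convergent (\<lambda>m. gasket_energy_level m f g)"
proof -
  let ?s = "\<lambda>m. gasket_energy_level m (\<lambda>x. f x + g x) (\<lambda>x. f x + g x)"
  obtain A B where A: "\<And>m. gasket_energy_level m f f \<le> A" and B: "\<And>m. gasket_energy_level m g g \<le> B"
    using convergent_imp_Bseq[OF f] convergent_imp_Bseq[OF g] unfolding Bseq_def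
    by (metis abs_le_D1 real_norm_def)
  \<comment> \<open>Parallelogram identity, with the energy of \<open>f - g\<close> dropped.\<close>
  have "?s m \<le> 2 * A + 2 * B" for m
    using gasket_energy_level_nonneg[of m "\<lambda>x. f x + - 1 * g x"] A[of m] B[of m]
      gasket_energy_level_add_scaled[of m f "- 1" g] gasket_energy_level_add_scaled[of m f 1 g]
    by simp
  moreover have "incseq ?s" by (rule incseq_SucI) (rule gasket_energy_level_mono)
  ultimately obtain L where "?s \<longlonglongrightarrow> L" using incseq_convergent[of ?s] by blast
  then have "convergent (\<lambda>m. 1/2 * (?s m - gasket_energy_level m f f - gasket_energy_level m g g))"
    by (intro convergent_mult convergent_diff convergent_const f g) (rule convergentI)
  then show ?thesis using gasket_energy_level_add_scaled[of _ f 1 g] by simp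
qed

section \<open>Scaling of the energy\<close>

lemma words_with_prefix:
  assumes "w \<in> words n"
  shows "{j \<in> words (m + n). take (length w) j = w} = (\<lambda>v. w @ v) ` words m"
proof
  show "{j \<in> words (m + n). take (length w) j = w} \<subseteq> (\<lambda>v. w @ v) ` words m"
  proof
    fix j assume j: "j \<in> {j \<in> words (m + n). take (length w) j = w}"
    then have "j = w @ drop (length w) j" by (metis (mono_tags) append_take_drop_id mem_Collect_eq)
    moreover have "drop (length w) j \<in> words m"
      using j assms set_drop_subset[of "length w" j] by (auto simp: words_def)
    ultimately show "j \<in> (\<lambda>v. w @ v) ` words m" by blast
  qed
qed (use assms in \<open>auto simp: words_def\<close>)

lemma cell_energy_level_eq:
  assumes w: "w \<in> words n"
  shows "cell_energy_level w (m + n) f g =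
    (5/3) ^ n * gasket_energy_level m (\<lambda>x. f (Fw w x)) (\<lambda>x. g (Fw w x))"
  unfolding cell_energy_level_def gasket_energy_level_def words_with_prefix[OF w]
  by (subst sum.reindex) (simp_all add: inj_on_def Fw_append power_add)

lemma cell_energy_level_tendsto_iff:
  assumes w: "w \<in> words n"
  shows "(\<lambda>m. cell_energy_level w m f g) \<longlonglongrightarrow> (5/3) ^ n * L \<longleftrightarrow>
    (\<lambda>m. gasket_energy_level m (\<lambda>x. f (Fw w x)) (\<lambda>x. g (Fw w x))) \<longlonglongrightarrow> L"
proof -
  have "(\<lambda>m. cell_energy_level w m f g) \<longlonglongrightarrow> (5/3) ^ n * L \<longleftrightarrow>
      (\<lambda>m. cell_energy_level w (m + n) f g) \<longlonglongrightarrow> (5/3) ^ n * L"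
    by (rule iffI) (erule LIMSEQ_ignore_initial_segment, erule LIMSEQ_offset)
  then show ?thesis unfolding cell_energy_level_eq[OF w] by (simp add: tendsto_mult_left_iff)
qed

lemma convergent_cell_energy_level_iff:
  assumes w: "w \<in> words n"
  shows "convergent (\<lambda>m. cell_energy_level w m f g) \<longleftrightarrow>
    convergent (\<lambda>m. gasket_energy_level m (\<lambda>x. f (Fw w x)) (\<lambda>x. g (Fw w x)))"
proof
  assume "convergent (\<lambda>m. cell_energy_level w m f g)"
  then obtain L where "(\<lambda>m. cell_energy_level w m f g) \<longlonglongrightarrow> (5/3) ^ n * (L / (5/3) ^ n)"
    by (auto simp: convergent_def)
  then show "convergent (\<lambda>m. gasket_energy_level m (\<lambda>x. f (Fw w x)) (\<lambda>x. g (Fw w x)))"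
    unfolding cell_energy_level_tendsto_iff[OF w] by (rule convergentI)
qed (use cell_energy_level_tendsto_iff[OF w] in \<open>auto simp: convergent_def\<close>)

lemma cell_domain_iff:
  assumes w: "w \<in> words n"
  shows "u \<in> cell_domain w \<longleftrightarrow> (\<lambda>x. u (Fw w x)) \<in> gasket_domain"
proof -
  have "continuous_on (cell w) u \<longleftrightarrow> continuous_on gasket (\<lambda>x. u (Fw w x))"
  proof
    assume "continuous_on (cell w) u"
    then show "continuous_on gasket (\<lambda>x. u (Fw w x))"
      by (rule continuous_on_compose2[OF _ continuous_on_Fw]) (simp add: cell_def)
  next
    assume "continuous_on gasket (\<lambda>x. u (Fw w x))"
    then have "continuous_on (cell w) (\<lambda>y. u (Fw w (inv (Fw w) y)))"
      by (rule continuous_on_compose2[OF _ continuous_on_inv_Fw])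
        (use inj_Fw[of w] in \<open>auto simp: cell_def\<close>)
    then show "continuous_on (cell w) u" by (simp add: surj_f_inv_f[OF surj_Fw])
  qed
  then show ?thesis
    by (simp add: cell_domain_def gasket_domain_def convergent_cell_energy_level_iff[OF w])
qed

lemma cell_energy_eq:
  assumes w: "w \<in> words n" and u: "u \<in> cell_domain w" and v: "v \<in> cell_domain w"
  shows "cell_energy w u v = (5/3) ^ n * gasket_energy (\<lambda>x. u (Fw w x)) (\<lambda>x. v (Fw w x))"
proof -
  let ?g = "\<lambda>m. gasket_energy_level m (\<lambda>x. u (Fw w x)) (\<lambda>x. v (Fw w x))"
  have "convergent ?g"
    by (rule convergent_gasket_energy_level)
      (use u v in \<open>auto simp: cell_domain_iff[OF w] gasket_domain_def\<close>)
  then have "?g \<longlonglongrightarrow> lim ?g" by (simp add: convergent_LIMSEQ_iff)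
  then have "(\<lambda>m. cell_energy_level w m u v) \<longlonglongrightarrow> (5/3) ^ n * lim ?g"
    by (simp only: cell_energy_level_tendsto_iff[OF w])
  then show ?thesis unfolding cell_energy_def gasket_energy_def by (rule limI)
qed

section \<open>Self-similarity of the field\<close>

lemma scaled_copy_cell:
  assumes \<mu>: "gasket_measure \<mu>" and w: "w \<in> words n"
  shows "scaled_copy \<mu> (restrict_space \<mu> (cell w)) (Fw w) (inv (Fw w))
    gasket_domain (cell_domain w) gasket_energy (cell_energy w) ((1/3) ^ n) ((5/3) ^ n)"
proof
  show "inv (Fw w) (Fw w x) = x" for x by (rule inv_f_f[OF inj_Fw])
  show "Fw w (inv (Fw w) y) = y" for y by (rule surj_f_inv_f[OF surj_Fw])
qed (simp_all add: Fw_measurable[OF \<mu> w] continuous_on_Fw distr_inv_Fw[OF \<mu> w]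
    cell_domain_iff[OF w] cell_energy_eq[OF w])

lemma scaling_exponent:
  "sqrt ((1/3) ^ n) * ((5/3) ^ n / (1/3) ^ n) powr ((d_h + 2 * H) / (2 * d_w)) = 2 powr (real n * H)"
proof -
  have pow2: "2 powr d_h = 3" "2 powr d_w = 5"
    by (simp_all add: d_h_def d_w_def powr_def)
  have "d_w > 0" by (simp add: d_w_def)
  have "(5/3) ^ n / (1/3) ^ n = (5::real) ^ n" by (simp add: power_divide)
  also have "\<dots> = 2 powr (real n * d_w)"
    by (metis pow2(2) powr_realpow powr_powr mult.commute zero_less_numeral)
  finally have r: "((5/3) ^ n / (1/3) ^ n) powr ((d_h + 2 * H) / (2 * d_w))
      = 2 powr (real n * (d_h + 2 * H) / 2)"
    using \<open>d_w > 0\<close> by (simp add: powr_powr)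
  have "((1/3) ^ n :: real) = inverse ((2 powr d_h) ^ n)" by (simp add: pow2 power_one_over inverse_eq_divide)
  also have "\<dots> = 2 powr (- (real n * d_h))"
    by (simp add: powr_minus powr_realpow[symmetric] powr_powr mult.commute)
  finally have c: "(1/3) ^ n = (2 powr (- (real n * d_h)) :: real)" .
  have "sqrt ((1/3) ^ n) = (2 powr (- (real n * d_h))) powr (1/2)"
    unfolding c by (rule powr_half_sqrt[symmetric]) simp
  then have "sqrt ((1/3) ^ n) = 2 powr (- real n * d_h / 2)" by (simp add: powr_powr)
  then show ?thesis unfolding r by (simp add: powr_add[symmetric] field_simps)
qed

theorem proposition3p11:
  fixes \<mu> :: "complex measure" and M :: "'a measure" and H :: real
    and n :: nat and w :: "nat list" and Xw :: "complex \<Rightarrow> 'a \<Rightarrow> real"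
  assumes "gasket_measure \<mu>"
    and "0 < H" and "H < d_w - d_h"
    and "w \<in> words n"
    and "cell_fbf \<mu> w M H Xw"
  shows "\<exists>(N :: 'a measure) X. gasket_fbf \<mu> N H X \<and>
           field_law gasket M (\<lambda>x \<omega>. 2 powr (real n * H) * Xw (Fw w x) \<omega>) = field_law gasket N X"
proof -
  note \<mu> = assms(1) and w = assms(4)
  let ?\<nu> = "restrict_space \<mu> (cell w)"
  interpret scaled_copy \<mu> ?\<nu> "Fw w" "inv (Fw w)" gasket_domain "cell_domain w"
    gasket_energy "cell_energy w" "(1/3) ^ n" "(5/3) ^ n"
    by (rule scaled_copy_cell[OF \<mu> w])
  have "cell w \<inter> space \<mu> = cell w"
    using cell_subset_gasket[OF w] by (auto simp: space_gasket_measure[OF \<mu>])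
  then have "measure ?\<nu> (space ?\<nu>) = measure \<mu> (cell w)"
    using cell_in_sets[OF \<mu> w] by (simp add: space_restrict_space measure_restrict_space)
  also have "\<dots> = (1/3) ^ n * measure \<mu> (space \<mu>)"
    using \<mu> w emeasure_gasket[OF \<mu>]
    unfolding space_gasket_measure[OF \<mu>] gasket_measure_def measure_def by simp
  finally have mass: "measure ?\<nu> (space ?\<nu>) = (1/3) ^ n * measure \<mu> (space \<mu>)" .
  have "gasket_fbf \<mu> M H (\<lambda>x \<omega>. 2 powr (real n * H) * Xw (Fw w x) \<omega>)"
    using fractional_brownian_field_pullback[OF assms(5)[unfolded cell_fbf_def] mass]
    unfolding scaling_exponent gasket_fbf_def .
  then show ?thesis by blast
qed

end
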